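(* Let $\nu\ge1$ and let $c_1,\dots,c_\nu\in[0,1]$ be pairwise distinct. For each $n$, let $\alpha_{0,n},\dots,\alpha_{\nu-1,n}\in X$ be the unique coefficients satisfying the interpolation conditions $$\sum_{j=0}^{\nu-1}\alpha_{j,n}(t_n+c_i\tau)^{jr}=h\bigl((t_n+c_i\tau)^r\bigr),\qquad i=1,\dots,\nu,$$ and consider the scheme (EQRF$\nu$) $$y_{n+1}=e^{\tau A}y_n+\tau\varphi_1(\tau A)\alpha_{0,n}+\sum_{j=1}^{\nu-1}\Gamma(1+jr)\Bigl((t_n+\tau)^{1+jr}\varphi_{1+jr}\bigl((t_n+\tau)A\bigr)-t_n^{1+jr}e^{\tau A}\varphi_{1+jr}(t_nA)\Bigr)\alpha_{j,n},$$ $n=0,\dots,N-1$, started from the exact initial value $y_0$. Let $\epsilon_n=y(t_n)-y_n$. Then: \begin{enumerate} \item if $h$ is $\nu$ times differentiable on $[0,\infty)$ with bounded derivatives $h',\dots,h^{(\nu)}$, then $$\|\epsilon_n\|\le\begin{cases}C\tau^{\min\{1+\nu r,\,\nu\}}, & r\neq\frac{\nu-1}{\nu},\\ C\tau^{\nu}\bigl(1+\lvert\log\tau\rvert\bigr), & r=\frac{\nu-1}{\nu};\end{cases}$$ \item if $h$ is $\nu+1$ times differentiable on $[0,\infty)$ with bounded derivatives $h',\dots,h^{(\nu+1)}$, if $h^{(\nu)}(x)\in\mathcal{D}(A)$ for all $x\ge0$ with $x\mapsto Ah^{(\nu)}(x)$ bounded, and if the points satisfy $$\int_0^1(s-c_1)\cdots(s-c_\nu)\,ds=\frac{1}{\nu+1}-\frac{c_1+\cdots+c_\nu}{\nu}+\sum_{i<j}\frac{c_ic_j}{\nu-1}-\sum_{i<j<k}\frac{c_ic_jc_k}{\nu-2}+\cdots+(-1)^\nu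 c_1\cdots c_\nu=0,$$ then $\|\epsilon_n\|\le C\tau^{1+\nu r}$. \end{enumerate} The bounds hold for all $N\in\mathbb{N}$ and $0\le n\le N$, with $C$ possibly depending on $T$ (and on $r,\nu,h,c_1,\dots,c_\nu$ and the semigroup) but not on $n$ or $\tau$.
   Context: $(X,\|\cdot\|)$ is a Banach space and $A:\mathcal{D}(A)\subset X\to X$ is a linear operator generating a strongly continuous semigroup $\{e^{tA}\}_{t\ge0}$ on $X$. Fix $T>0$, $0<r<1$, $y_0\in X$ and $h:[0,\infty)\to X$. The problem is $y'(t)=Ay(t)+h(t^r)$, $y(0)=y_0$, $t\in[0,T]$, with (mild) solution $y(t)=e^{tA}y_0+\int_0^te^{(t-s)A}h(s^r)\,ds$. Time grid: $N\in\mathbb{N}$, $\tau=T/N$, $t_n=n\tau$. For $\lambda>0$ and $t\ge0$ the fractional $\varphi$ function is the bounded operator $\varphi_\lambda(tA)v=\frac{1}{\Gamma(\lambda)}\int_0^1e^{(1-\theta)tA}\theta^{\lambda-1}v\,d\theta$ ($v\in X$), $\Gamma$ being Euler's gamma function; in particular $\tau\varphi_1(\tau A)v=\int_0^\tau e^{(\tau-s)A}v\,ds$. Convention $0^{1+jr}=0$. *)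

theory Defs
  imports "HOL-Analysis.Analysis"
begin

definition c0_semigroup :: "(real \<Rightarrow> 'a::banach \<Rightarrow>\<^sub>L 'a) \<Rightarrow> bool" where
  "c0_semigroup S \<longleftrightarrow>
     S 0 = id_blinfun \<and>
     (\<forall>s t. 0 \<le> s \<longrightarrow> 0 \<le> t \<longrightarrow> S (s + t) = S s o\<^sub>L S t) \<and>
     (\<forall>x. ((\<lambda>t. blinfun_apply (S t) x) \<longlongrightarrow> x) (at_right 0))"

definition is_generator ::
  "(real \<Rightarrow> 'a::banach \<Rightarrow>\<^sub>L 'a) \<Rightarrow> 'a set \<Rightarrow> ('a \<Rightarrow> 'a) \<Rightarrow> bool" where
  "is_generator S DA A \<longleftrightarrow>
     DA = {x. \<exists>y. ((\<lambda>t. (1 / t) *\<^sub>R (blinfun_apply (S t) x - x)) \<longlongrightarrow> y) (at_right 0)} \<and>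
     (\<forall>x\<in>DA. ((\<lambda>t. (1 / t) *\<^sub>R (blinfun_apply (S t) x - x)) \<longlongrightarrow> A x) (at_right 0))"

definition phi :: "(real \<Rightarrow> 'a::banach \<Rightarrow>\<^sub>L 'a) \<Rightarrow> real \<Rightarrow> real \<Rightarrow> 'a \<Rightarrow> 'a" where
  "phi S lam t v = (1 / Gamma lam) *\<^sub>R
     integral {0..1} (\<lambda>\<theta>. (\<theta> powr (lam - 1)) *\<^sub>R blinfun_apply (S ((1 - \<theta>) * t)) v)"

definition mild_sol :: "(real \<Rightarrow> 'a::banach \<Rightarrow>\<^sub>L 'a) \<Rightarrow> (real \<Rightarrow> 'a) \<Rightarrow> real \<Rightarrow> 'a \<Rightarrow> real \<Rightarrow> 'a" where
  "mild_sol S h r y0 t = blinfun_apply (S t) y0 +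
     integral {0..t} (\<lambda>s. blinfun_apply (S (t - s)) (h (s powr r)))"

text \<open>Interpolation coefficients alpha_0..alpha_{nu-1} (extended by 0 for j >= nu):
  sum_{j<nu} alpha_j (t + c_i tau)^{j r} = h((t + c_i tau)^r), i = 1..nu.
  Here x^{jr} is written ((x^r)^j), so that x^0 = 1 also for x = 0.\<close>
definition interp_coef ::
  "(real \<Rightarrow> 'a::banach) \<Rightarrow> real \<Rightarrow> nat \<Rightarrow> (nat \<Rightarrow> real) \<Rightarrow> real \<Rightarrow> real \<Rightarrow> nat \<Rightarrow> 'a" where
  "interp_coef h r \<nu> c t \<tau> = (THE \<alpha>. (\<forall>j\<ge>\<nu>. \<alpha> j = 0) \<and>
      (\<forall>i\<in>{1..\<nu>}. (\<Sum>j<\<nu>. (((t + c i * \<tau>) powr r) ^ j) *\<^sub>R \<alpha> j) = h ((t + c i * \<tau>) powr r)))"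

primrec eqrf ::
  "(real \<Rightarrow> 'a::banach \<Rightarrow>\<^sub>L 'a) \<Rightarrow> (real \<Rightarrow> 'a) \<Rightarrow> real \<Rightarrow> nat \<Rightarrow> (nat \<Rightarrow> real) \<Rightarrow> real \<Rightarrow> 'a \<Rightarrow> nat \<Rightarrow> 'a" where
  "eqrf S h r \<nu> c \<tau> y0 0 = y0"
| "eqrf S h r \<nu> c \<tau> y0 (Suc n) =
     (let t = real n * \<tau>; \<alpha> = interp_coef h r \<nu> c t \<tau> in
       blinfun_apply (S \<tau>) (eqrf S h r \<nu> c \<tau> y0 n)
       + \<tau> *\<^sub>R phi S 1 \<tau> (\<alpha> 0)
       + (\<Sum>j\<in>{1..<\<nu>}. Gamma (1 + real j * r) *\<^sub>R
            ((t + \<tau>) powr (1 + real j * r) *\<^sub>R phi S (1 + real j * r) (t + \<tau>) (\<alpha> j)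
             - t powr (1 + real j * r) *\<^sub>R blinfun_apply (S \<tau>) (phi S (1 + real j * r) t (\<alpha> j)))))"

end

theory Submission
  imports Defs "HOL-Computational_Algebra.Polynomial"
begin

text \<open>
  The scheme replaces \<open>h (s powr r)\<close> in the variation-of-constants formula by its interpolant in the
  variable \<open>s powr r\<close>, so the error is a sum of local defects transported by the semigroup, which is
  bounded on \<open>{0..T}\<close>. On the \<open>k\<close>-th step the nodes are \<open>\<tau> powr r * (k + c i) powr r\<close>; their spread
  and their mutual distances are all comparable to \<open>\<tau> powr r * max 1 k powr (r - 1)\<close>. Hence the
  Lebesgue constants are bounded uniformly in \<open>k\<close> and \<open>\<tau>\<close>, and Taylor expansion at the left endpoint bounds the
  defect by \<open>\<tau>\<close> times the \<open>\<nu>\<close>-th power of that width; summing powers of \<open>k\<close> gives the three regimes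
  of the first estimate. For the second, the leading term of the interpolation error is \<open>D \<nu>\<close> times the
  node polynomial, which agrees to first order with a multiple of \<open>\<Prod>i. (\<theta> - c i)\<close>; this has integral zero, and
  on the domain of the generator replacing \<open>S t\<close> by the identity costs only \<open>O(t)\<close>.
\<close>

section \<open>Strongly continuous semigroups\<close>

text \<open>The obstacle is the time origin: \<open>s powr r\<close> has an unbounded derivative
  there, so nothing is expanded in \<open>s\<close> itself. Taylor and Lagrange arguments run in the
  variable \<open>s powr r\<close>, where \<open>h\<close> is smooth, and all that is needed of the
  powers is two-sided control of their increments within one step; \<open>max 1 k\<close> lets the
  first step obey the same bounds as the others. With w of order \<tau>^r k^(r-1), the first
  estimate becomes \<tau>^(1+\<nu>r) times the sum of k^((r-1)\<nu>), and the exponent is compared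
  with -1. In the second estimate that sum may grow, so the leading term has to cancel within each
  single step. Per step there remain w^(\<nu>+1) from the Taylor remainder, w^\<nu>/k from
  linearising the node polynomial, and \<tau> w^\<nu> from replacing the semigroup by the identity.
  Since w^\<nu> is at most \<tau>^(\<nu>r), while the sums over the grid of w, of k^(r-2) and of
  \<tau> are all bounded, each source contributes O(\<tau>^(1+\<nu>r)).\<close>

lemma uniform_boundedness:
  fixes F :: "'i \<Rightarrow> 'a::banach \<Rightarrow>\<^sub>L 'b::real_normed_vector"
  assumes pw: "\<And>x. \<exists>C. \<forall>i\<in>I. norm (F i x) \<le> C"
  shows "\<exists>C. \<forall>i\<in>I. norm (F i) \<le> C"
proof -
  define G where "G k = {x. \<forall>i\<in>I. norm (F i x) \<le> real k}" for k :: nat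
  have cl: "closed (G k)" for k
  proof -
    have "G k = (\<Inter>i\<in>I. {x. norm (F i x) \<le> real k})"
      by (auto simp: G_def)
    then show ?thesis
      by (auto intro!: closed_INT closed_Collect_le continuous_intros)
  qed
  have UN: "\<Union>(range G) = UNIV"
  proof -
    have "\<exists>k. x \<in> G k" for x
    proof -
      obtain C where "\<forall>i\<in>I. norm (F i x) \<le> C" using pw by blast
      moreover obtain k :: nat where "C \<le> real k" using real_arch_simple by blast
      ultimately have "\<forall>i\<in>I. norm (F i x) \<le> real k" by (meson order_trans)
      then show ?thesis unfolding G_def by blast
    qed
    then show ?thesis by blast
  qed
  obtain k where k: "interior (G k) \<noteq> {}"
  proof (rule ccontr)
    assume "\<not> thesis"
    then have none: "\<And>k. interior (G k) = {}" using that by blast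
    have "euclidean interior_of \<Union>(range G) = ({}::'a set)"
      by (rule Baire_category_alt) (use none cl completely_metrizable_space_euclidean in auto)
    then show False using UN by simp
  qed
  then obtain x e where e: "e > 0" "cball x e \<subseteq> G k"
    by (meson all_not_in_conv mem_interior_cball)
  \<comment> \<open>Linearity moves the ball from \<open>x\<close> to the origin: for
    \<open>u\<close> of norm \<open>e\<close>, \<open>F i u\<close> is a difference of two values
    bounded by \<open>k\<close>, and rescaling \<open>u\<close> to \<open>v\<close> yields
    \<open>2 * k / e\<close>.\<close>
  have "norm (F i) \<le> 2 * real k / e" if i: "i \<in> I" for i
  proof (rule norm_blinfun_bound)
    fix v
    show "norm (F i v) \<le> 2 * real k / e * norm v"
    proof (cases "v = 0")
      case False
      define u where "u = (e / norm v) *\<^sub>R v"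
      have nu: "norm u = e" using False e by (simp add: u_def)
      have "x + u \<in> G k" "x \<in> G k" using e nu by (auto simp: dist_norm subset_iff)
      then have "norm (F i (x + u)) \<le> k" "norm (F i x) \<le> k"
        using i by (auto simp: G_def)
      moreover have "F i u = F i (x + u) - F i x" by (simp add: blinfun.add_right)
      ultimately have "norm (F i u) \<le> 2 * k"
        using norm_triangle_ineq4[of "F i (x + u)" "F i x"] by simp
      moreover have "norm (F i u) = e / norm v * norm (F i v)"
        using e by (simp add: u_def blinfun.scaleR_right)
      ultimately show ?thesis using False e by (simp add: field_simps)
    qed simp
  qed (use e in simp)
  then show ?thesis by blast
qed

lemma c0_semigroup_0: "c0_semigroup S \<Longrightarrow> S 0 x = x"
  by (simp add: c0_semigroup_def)

lemma c0_semigroup_add: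
  "c0_semigroup S \<Longrightarrow> 0 \<le> s \<Longrightarrow> 0 \<le> t \<Longrightarrow> S (s + t) x = S s (S t x)"
  by (simp add: c0_semigroup_def)

lemma c0_semigroup_tendsto:
  "c0_semigroup S \<Longrightarrow> ((\<lambda>t. S t x) \<longlongrightarrow> x) (at_right 0)"
  by (simp add: c0_semigroup_def)

text \<open>Failure would give times \<open>t n\<close> tending to 0 with
  \<open>norm (S (t n)) > n\<close>. Along this sequence every single orbit converges and is
  therefore bounded, which contradicts uniform boundedness. A sequence is needed because orbits are
  not yet known to be bounded on any interval common to all \<open>x\<close>.\<close>

lemma c0_semigroup_bounded_near_0:
  fixes S :: "real \<Rightarrow> 'a::banach \<Rightarrow>\<^sub>L 'a"
  assumes sg: "c0_semigroup S"
  obtains d C where "d > 0" "\<And>t. 0 \<le> t \<Longrightarrow> t \<le> d \<Longrightarrow> norm (S t) \<le> C"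
proof -
  have "\<exists>n C. \<forall>t\<in>{0..inverse (real (Suc n))}. norm (S t) \<le> C"
  proof (rule ccontr)
    assume "\<not> ?thesis"
    then have "\<forall>n. \<exists>t\<in>{0..inverse (real (Suc n))}. \<not> norm (S t) \<le> real n" by meson
    then obtain t where t: "\<And>n. t n \<in> {0..inverse (real (Suc n))}" "\<And>n. \<not> norm (S (t n)) \<le> real n"
      by metis
    have t0: "t \<longlonglongrightarrow> 0"
      by (rule tendsto_sandwich[OF _ _ tendsto_const LIMSEQ_inverse_real_of_nat])
        (use t(1) in auto)
    have "\<exists>C. \<forall>n\<in>UNIV. norm (S (t n) x) \<le> C" for x
    proof -
      have "((\<lambda>t. S t x) \<longlongrightarrow> x) (at 0 within {0..})"
        using c0_semigroup_tendsto[OF sg, of x] c0_semigroup_0[OF sg, of x]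
        by (metis at_within_Ici_at_right)
      then have "continuous (at 0 within {0..}) (\<lambda>t. S t x)"
        by (simp add: continuous_within c0_semigroup_0[OF sg])
      then have "(\<lambda>n. S (t n) x) \<longlonglongrightarrow> S 0 x"
        using t(1) t0 by (auto simp: continuous_within_sequentially comp_def)
      then have "Bseq (\<lambda>n. S (t n) x)"
        using convergent_imp_Bseq convergentI by blast
      then show ?thesis by (auto simp: Bseq_def)
    qed
    from uniform_boundedness[of UNIV "\<lambda>n. S (t n)", OF this]
    obtain C where C: "\<forall>n\<in>UNIV. norm (S (t n)) \<le> C" ..
    obtain n where "C \<le> real n" using real_arch_simple by blast
    moreover have "norm (S (t n)) \<le> C" using C by simp
    ultimately show False using t(2)[of n] by simp
  qed
  then obtain n C where "\<forall>t\<in>{0..inverse (real (Suc n))}. norm (S t) \<le> C" by blast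
  then show ?thesis using that[of "inverse (real (Suc n))" C] by simp
qed

text \<open>Every time up to \<open>T\<close> is cut into the same number \<open>Suc n\<close> of
  steps of length at most \<open>d\<close>, so one power of the bound near 0 serves for all of them.
  Having \<open>M \<ge> 1\<close> makes \<open>M\<close> usable both as a factor in inequalities and
  as a divisor.\<close>

lemma c0_semigroup_bounded_on:
  fixes S :: "real \<Rightarrow> 'a::banach \<Rightarrow>\<^sub>L 'a"
  assumes sg: "c0_semigroup S"
  obtains M where "M \<ge> 1" "\<And>t x. 0 \<le> t \<Longrightarrow> t \<le> T \<Longrightarrow> norm (S t x) \<le> M * norm x"
proof -
  obtain d C where d: "d > 0" "\<And>t. 0 \<le> t \<Longrightarrow> t \<le> d \<Longrightarrow> norm (S t) \<le> C"
    using c0_semigroup_bounded_near_0[OF sg] by blast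
  define B where "B = max 1 C"
  have B1: "B \<ge> 1" by (simp add: B_def)
  have B: "norm (S t x) \<le> B * norm x" if "0 \<le> t" "t \<le> d" for t x
    using norm_blinfun[of "S t" x] d(2)[OF that]
    by (smt (verit) B_def mult_right_mono norm_ge_zero)
  have pow: "norm (S (real n * t) x) \<le> B ^ n * norm x" if "0 \<le> t" "t \<le> d" for t x n
  proof (induction n)
    case (Suc n)
    have "S (real (Suc n) * t) x = S t (S (real n * t) x)"
      using c0_semigroup_add[OF sg, of t "real n * t" x] that by (simp add: algebra_simps)
    also have "norm \<dots> \<le> B * norm (S (real n * t) x)" using B that by blast
    also have "\<dots> \<le> B * (B ^ n * norm x)" using Suc B1 by (intro mult_left_mono) auto
    finally show ?case by (simp add: mult_ac)
  qed (simp add: c0_semigroup_0[OF sg])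
  obtain n :: nat where n: "T / d \<le> real n" using real_arch_simple by blast
  show ?thesis
  proof (rule that[of "B ^ Suc n"])
    show "1 \<le> B ^ Suc n" using B1 by (rule one_le_power)
    fix t x assume t: "0 \<le> t" "t \<le> T"
    have "t / real (Suc n) \<le> d" 
    proof -
      have "T \<le> real n * d" using n d by (simp add: field_simps)
      then have "t \<le> real (Suc n) * d" using t d by (simp add: algebra_simps)
      then show ?thesis by (simp add: field_simps)
    qed
    from pow[OF _ this, of "Suc n" x] t show "norm (S t x) \<le> B ^ Suc n * norm x" by simp
  qed
qed

text \<open>Factoring out the operator at the smaller time leaves only the continuity at 0 from the
  right. The same estimate thus covers left and right continuity, without negative times.\<close>

lemma c0_semigroup_continuous_on:
  fixes S :: "real \<Rightarrow> 'a::banach \<Rightarrow>\<^sub>L 'a"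
  assumes sg: "c0_semigroup S"
  shows "continuous_on {0..} (\<lambda>t. S t x)"
proof -
  have "\<exists>e>0. \<forall>s\<in>{0..}. dist s t < e \<longrightarrow> dist (S s x) (S t x) < eps"
    if t: "t \<in> {0..}" and eps: "eps > 0" for t eps
  proof -
    obtain M where M: "M \<ge> 1" "\<And>s x. 0 \<le> s \<Longrightarrow> s \<le> t + 1 \<Longrightarrow> norm (S s x) \<le> M * norm x"
      using c0_semigroup_bounded_on[OF sg] by blast
    have "\<forall>\<^sub>F s in at_right 0. dist (S s x) x < eps / M"
      using c0_semigroup_tendsto[OF sg, of x] M(1) eps by (intro tendstoD) auto
    then obtain b where b: "b > 0" "\<And>s. 0 < s \<Longrightarrow> s < b \<Longrightarrow> dist (S s x) x < eps / M"
      by (auto simp: eventually_at_right_field)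
    have near: "norm (S v x - S u x) < eps" if uv: "0 \<le> u" "u \<le> v" "v - u < b" "u \<le> t + 1" for u v
    proof (cases "u = v")
      case False
      have "S v x - S u x = S u (S (v - u) x - x)"
        using c0_semigroup_add[OF sg, of u "v - u" x] uv by (simp add: blinfun.diff_right)
      also have "norm \<dots> \<le> M * norm (S (v - u) x - x)" using M(2) uv by simp
      also have "\<dots> < M * (eps / M)"
        using b(2)[of "v - u"] uv False M(1) by (intro mult_strict_left_mono) (auto simp: dist_norm)
      finally show ?thesis using M(1) by simp
    qed (use eps in simp)
    show ?thesis
    proof (intro exI[of _ "min b 1"] conjI ballI impI)
      fix s assume s: "s \<in> {0..}" "dist s t < min b 1"
      show "dist (S s x) (S t x) < eps"
      proof (cases "s \<le> t")
        case True
        then show ?thesis using near[of s t] s t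
          by (simp add: dist_norm norm_minus_commute)
      next
        case False
        then show ?thesis using near[of t s] s t by (simp add: dist_norm)
      qed
    qed (use b in auto)
  qed
  then show ?thesis by (simp add: continuous_on_iff)
qed

text \<open>Continuity is only strong, not in operator norm, so the claim is not a composition of
  continuous maps. The argument of the operator is frozen at \<open>f u\<close>, and the change
  \<open>f s - f u\<close> is absorbed by the bound on compact time intervals.\<close>

lemma c0_semigroup_continuous_on_compose:
  fixes S :: "real \<Rightarrow> 'a::banach \<Rightarrow>\<^sub>L 'a" and a b :: real
  assumes sg: "c0_semigroup S"
    and g: "continuous_on {a..b} g" "\<And>s. s \<in> {a..b} \<Longrightarrow> 0 \<le> g s"
    and f: "continuous_on {a..b} f"
  shows "continuous_on {a..b} (\<lambda>s. S (g s) (f s))"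
proof -
  obtain T where T: "\<And>s. s \<in> {a..b} \<Longrightarrow> g s \<le> T"
  proof -
    have "bounded (g ` {a..b})"
      using compact_continuous_image[OF g(1)] compact_imp_bounded by blast
    then obtain B where "\<forall>x\<in>g ` {a..b}. norm x \<le> B" by (auto simp: bounded_iff)
    then show thesis by (intro that[of B]) (fastforce simp: abs_le_iff)
  qed
  obtain M where M: "M \<ge> 1" "\<And>s x. 0 \<le> s \<Longrightarrow> s \<le> T \<Longrightarrow> norm (S s x) \<le> M * norm x"
    using c0_semigroup_bounded_on[OF sg] by blast
  have "((\<lambda>s. S (g s) (f s)) \<longlongrightarrow> S (g u) (f u)) (at u within {a..b})" if u: "u \<in> {a..b}" for u
  proof -
    have c: "continuous_on {a..b} (\<lambda>s. S (g s) (f u))"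
      by (rule continuous_on_compose2[OF c0_semigroup_continuous_on[OF sg] g(1)]) (use g(2) in blast)
    have 1: "((\<lambda>s. S (g s) (f u)) \<longlongrightarrow> S (g u) (f u)) (at u within {a..b})"
      using c u unfolding continuous_on_def by blast
    have 2: "((\<lambda>s. S (g s) (f s - f u)) \<longlongrightarrow> 0) (at u within {a..b})"
    proof (rule Lim_null_comparison)
      show "\<forall>\<^sub>F s in at u within {a..b}. norm (S (g s) (f s - f u)) \<le> M * norm (f s - f u)"
        unfolding eventually_at_filter by (intro always_eventually allI impI M(2) g(2) T)
      have "((\<lambda>s. M * norm (f s - f u)) \<longlongrightarrow> M * norm (f u - f u)) (at u within {a..b})"
        using f u unfolding continuous_on_def by (intro tendsto_intros) blast
      then show "((\<lambda>s. M * norm (f s - f u)) \<longlongrightarrow> 0) (at u within {a..b})" by simp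
    qed
    show ?thesis using tendsto_add[OF 1 2] by (simp add: blinfun.diff_right)
  qed
  then show ?thesis unfolding continuous_on_def by blast
qed

text \<open>Splitting \<open>S t x - x\<close> into \<open>m\<close> steps of length \<open>t/m\<close> and letting \<open>m\<close> tend to infinity
  uses only the difference quotient at \<open>0\<close>.\<close>
lemma generator_norm_diff_le:
  fixes S :: "real \<Rightarrow> 'a::banach \<Rightarrow>\<^sub>L 'a"
  assumes sg: "c0_semigroup S" and gen: "is_generator S DA A" and x: "x \<in> DA"
    and M: "\<And>s y. 0 \<le> s \<Longrightarrow> s \<le> T \<Longrightarrow> norm (S s y) \<le> M * norm y"
    and t: "0 \<le> t" "t \<le> T"
  shows "norm (S t x - x) \<le> M * t * norm (A x)"
proof (cases "t = 0")
  case False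
  with t have t0: "t > 0" by simp
  have step: "norm (S t x - x) \<le> M * t * norm ((1 / (t / real (Suc m))) *\<^sub>R (S (t / real (Suc m)) x - x))" for m
  proof -
    let ?m = "Suc m" and ?d = "t / real (Suc m)"
    have "S t x - x = (\<Sum>k<?m. S (real (Suc k) * ?d) x - S (real k * ?d) x)"
      using sum_lessThan_telescope[of "\<lambda>k. S (real k * ?d) x" ?m] c0_semigroup_0[OF sg]
      by simp
    also have "\<dots> = (\<Sum>k<?m. S (real k * ?d) (S ?d x - x))"
    proof (intro sum.cong refl)
      fix k
      show "S (real (Suc k) * ?d) x - S (real k * ?d) x = S (real k * ?d) (S ?d x - x)"
        using c0_semigroup_add[OF sg, of "real k * ?d" ?d x] t
        by (simp add: blinfun.diff_right algebra_simps add_divide_distrib)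
    qed
    also have "norm \<dots> \<le> (\<Sum>k<?m. M * norm (S ?d x - x))"
    proof (rule sum_norm_le)
      fix k assume k: "k \<in> {..<?m}"
      have "real k * ?d \<le> real ?m * ?d" using k t by (intro mult_right_mono) auto
      then have "real k * ?d \<le> t" by simp
      then show "norm (S (real k * ?d) (S ?d x - x)) \<le> M * norm (S ?d x - x)"
        using t by (intro M) auto
    qed
    also have "\<dots> = M * t * norm ((1 / ?d) *\<^sub>R (S ?d x - x))"
      using t0 unfolding norm_scaleR by simp
    finally show ?thesis .
  qed
  have "filterlim (\<lambda>m. t / real (Suc m)) (at_right 0) sequentially"
  proof -
    have "(\<lambda>m. t * inverse (real (Suc m))) \<longlonglongrightarrow> t * 0"
      by (intro tendsto_intros LIMSEQ_inverse_real_of_nat)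
    then have "(\<lambda>m. t / real (Suc m)) \<longlonglongrightarrow> 0" by (simp add: divide_inverse)
    then show ?thesis using t0 by (auto simp: filterlim_at)
  qed
  moreover have "((\<lambda>u. (1 / u) *\<^sub>R (S u x - x)) \<longlongrightarrow> A x) (at_right 0)"
    using gen x by (simp add: is_generator_def)
  ultimately have "(\<lambda>m. (1 / (t / real (Suc m))) *\<^sub>R (S (t / real (Suc m)) x - x)) \<longlonglongrightarrow> A x"
    using filterlim_compose by blast
  then have "(\<lambda>m. M * t * norm ((1 / (t / real (Suc m))) *\<^sub>R (S (t / real (Suc m)) x - x)))
      \<longlonglongrightarrow> M * t * norm (A x)"
    by (intro tendsto_intros)
  then show ?thesis by (rule LIMSEQ_le_const) (use step in blast)
qed (simp add: c0_semigroup_0[OF sg])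

section \<open>Lagrange interpolation with vector values\<close>

definition lagrange_basis :: "('i \<Rightarrow> 'a::field) \<Rightarrow> 'i set \<Rightarrow> 'i \<Rightarrow> 'a poly" where
  "lagrange_basis x I i = (\<Prod>j\<in>I - {i}. smult (1 / (x i - x j)) [:- x j, 1:])"

lemma poly_lagrange_basis:
  "poly (lagrange_basis x I i) z = (\<Prod>j\<in>I - {i}. (z - x j) / (x i - x j))"
  by (simp add: lagrange_basis_def poly_prod diff_divide_distrib)

lemma degree_lagrange_basis_less:
  assumes "finite I" "i \<in> I"
  shows "degree (lagrange_basis x I i) < card I"
proof -
  have "degree (lagrange_basis x I i) \<le> (\<Sum>j\<in>I - {i}. degree (smult (1 / (x i - x j)) [:- x j, 1:]))"
    unfolding lagrange_basis_def using assms(1)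
      degree_prod_sum_le[of "I - {i}" "\<lambda>j. smult (1 / (x i - x j)) [:- x j, 1:]"]
    by (simp add: comp_def)
  also have "\<dots> \<le> (\<Sum>j\<in>I - {i}. 1)" by (rule sum_mono) simp
  also have "\<dots> < card I" using assms by (auto simp: card_gt_0_iff intro!: diff_less)
  finally show ?thesis .
qed

lemma poly_lagrange_basis_coeff:
  assumes "finite I" "i \<in> I"
  shows "(\<Sum>j<card I. z ^ j * coeff (lagrange_basis x I i) j) = poly (lagrange_basis x I i) z"
  using degree_lagrange_basis_less[OF assms, of x]
  by (subst poly_altdef) (auto intro!: sum.mono_neutral_cong_right coeff_eq_0 simp: mult.commute)

lemma poly_lagrange_basis_node:
  assumes "finite I" "inj_on x I" "i \<in> I" "k \<in> I"
  shows "poly (lagrange_basis x I i) (x k) = (if k = i then 1 else 0)"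
proof (cases "k = i")
  case True
  then show ?thesis using assms
    by (auto simp: poly_lagrange_basis inj_on_eq_iff intro!: prod.neutral)
next
  case False
  then show ?thesis using assms by (auto simp: poly_lagrange_basis)
qed

lemma sum_lagrange_basis_node:
  assumes "finite I" "inj_on x I" "k \<in> I"
  shows "(\<Sum>i\<in>I. poly (lagrange_basis x I i) (x k) *\<^sub>R f i) = (f k :: 'a::real_vector)"
proof -
  have "(\<Sum>i\<in>I. poly (lagrange_basis x I i) (x k) *\<^sub>R f i) = (\<Sum>i\<in>I. if k = i then f i else 0)"
    using assms by (intro sum.cong) (auto simp: poly_lagrange_basis_node)
  then show ?thesis using assms by simp
qed

lemma lagrange_interpolation:
  fixes x :: "'i \<Rightarrow> 'a::field"
  assumes fin: "finite I" and inj: "inj_on x I" and deg: "degree p < card I"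
  shows "p = (\<Sum>i\<in>I. smult (poly p (x i)) (lagrange_basis x I i))"
proof (rule poly_eqI_degree[where A = "x ` I"])
  fix z assume "z \<in> x ` I"
  then obtain k where k: "k \<in> I" "z = x k" by blast
  have "(\<Sum>i\<in>I. poly p (x i) * poly (lagrange_basis x I i) (x k)) = (\<Sum>i\<in>I. if k = i then poly p (x i) else 0)"
    using fin inj k by (intro sum.cong) (auto simp: poly_lagrange_basis_node)
  then show "poly p z = poly (\<Sum>i\<in>I. smult (poly p (x i)) (lagrange_basis x I i)) z"
    using fin k by (simp add: poly_sum)
next
  have "degree (\<Sum>i\<in>I. smult (poly p (x i)) (lagrange_basis x I i)) \<le> card I - 1"
  proof (rule degree_sum_le[OF fin])
    fix i assume "i \<in> I"
    then show "degree (smult (poly p (x i)) (lagrange_basis x I i)) \<le> card I - 1"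
      using degree_lagrange_basis_less[OF fin \<open>i \<in> I\<close>, of x]
        degree_smult_le[of "poly p (x i)" "lagrange_basis x I i"] by linarith
  qed
  then show "degree (\<Sum>i\<in>I. smult (poly p (x i)) (lagrange_basis x I i)) < card (x ` I)"
    using deg inj by (simp add: card_image)
qed (use deg inj in \<open>simp add: card_image\<close>)

lemma lagrange_power_reproduce:
  fixes x :: "'i \<Rightarrow> 'a::field"
  assumes fin: "finite I" and inj: "inj_on x I" and j: "j < card I"
  shows "(\<Sum>i\<in>I. (x i - a) ^ j * poly (lagrange_basis x I i) z) = (z - a) ^ j"
proof -
  have "degree ([:-a, 1:] ^ j) < card I" using j by (simp add: degree_power_eq)
  from arg_cong[OF lagrange_interpolation[OF fin inj this], of "\<lambda>p. poly p z"]
  show ?thesis by (simp add: poly_sum poly_power)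
qed

text \<open>The interpolation error of a monic polynomial of degree \<open>card I\<close> is monic
  and vanishes at all nodes, so it is the node polynomial, whatever the shift \<open>a\<close>. This
  isolates the exact leading term of the error.\<close>

lemma lagrange_power_error:
  fixes x :: "'i \<Rightarrow> 'a::field"
  assumes fin: "finite I" and inj: "inj_on x I"
  shows "(z - a) ^ card I - (\<Sum>i\<in>I. (x i - a) ^ card I * poly (lagrange_basis x I i) z) = (\<Prod>i\<in>I. z - x i)"
proof -
  define n where "n = card I"
  define P where "P = (\<Prod>i\<in>I. [:- x i, 1:])"
  define L where "L = (\<Sum>i\<in>I. smult ((x i - a) ^ n) (lagrange_basis x I i))"
  have dP: "degree P = n" unfolding P_def n_def by (subst degree_prod_eq_sum_degree) auto
  have cP: "coeff P n = 1" using dP lead_coeff_prod[of "\<lambda>i. [:- x i, 1:]" I] by (simp add: P_def)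
  have coL: "coeff L n = 0"
    unfolding L_def by (auto simp: coeff_sum n_def intro!: sum.neutral coeff_eq_0 degree_lagrange_basis_less[OF fin])
  have dL: "degree L \<le> n"
    unfolding L_def n_def using degree_lagrange_basis_less[OF fin, of _ x]
    by (intro degree_sum_le[OF fin] order.trans[OF degree_smult_le] less_imp_le)
  \<comment> \<open>Two polynomials of degree \<open>n\<close> are compared at \<open>n\<close>
    nodes only; the equality of the coefficients of order \<open>n\<close> makes up for the missing
    node.\<close>
  have "[:-a, 1:] ^ n = P + L"
  proof (rule poly_eqI_degree_lead_coeff[where n = n and A = "x ` I"])
    show "coeff ([:-a, 1:] ^ n) n = coeff (P + L) n"
      using cP coL lead_coeff_power[of "[:-a, 1:]" n] by (simp add: degree_power_eq)
    show "degree (P + L) \<le> n" using dP dL by (intro degree_add_le) auto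
    fix z assume "z \<in> x ` I"
    then obtain k where k: "k \<in> I" "z = x k" by blast
    have "poly P z = 0" using k fin by (auto simp: P_def poly_prod)
    moreover have "(\<Sum>i\<in>I. (x i - a) ^ n * poly (lagrange_basis x I i) (x k)) = (\<Sum>i\<in>I. if k = i then (x i - a) ^ n else 0)"
      using fin inj k by (intro sum.cong) (auto simp: poly_lagrange_basis_node)
    ultimately show "poly ([:-a, 1:] ^ n) z = poly (P + L) z"
      using fin k by (simp add: L_def poly_sum poly_power)
  qed (use inj in \<open>auto simp: degree_power_eq card_image n_def\<close>)
  from arg_cong[OF this, of "\<lambda>p. poly p z"] show ?thesis
    by (simp add: P_def L_def poly_sum poly_power poly_prod n_def algebra_simps)
qed

text \<open>Scalar reproduction of shifted powers extends linearly to vector coefficients. It allows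
  a Taylor polynomial about any centre \<open>a\<close> to be subtracted before interpolation errors
  are estimated.\<close>

lemma lagrange_sum_reproduce:
  fixes d :: "nat \<Rightarrow> 'a::real_vector"
  assumes fin: "finite I" and inj: "inj_on x I" and m: "m \<le> card I"
  shows "(\<Sum>i\<in>I. poly (lagrange_basis x I i) z *\<^sub>R (\<Sum>j<m. (x i - a) ^ j *\<^sub>R d j)) = (\<Sum>j<m. (z - a) ^ j *\<^sub>R d j)"
proof -
  have "(\<Sum>i\<in>I. poly (lagrange_basis x I i) z *\<^sub>R (\<Sum>j<m. (x i - a) ^ j *\<^sub>R d j)) =
      (\<Sum>i\<in>I. \<Sum>j<m. ((x i - a) ^ j * poly (lagrange_basis x I i) z) *\<^sub>R d j)"
    by (simp add: scaleR_sum_right mult.commute)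
  also have "\<dots> = (\<Sum>j<m. (\<Sum>i\<in>I. (x i - a) ^ j * poly (lagrange_basis x I i) z) *\<^sub>R d j)"
    by (subst sum.swap) (simp add: scaleR_sum_left)
  also have "\<dots> = (\<Sum>j<m. (z - a) ^ j *\<^sub>R d j)"
    using lagrange_power_reproduce[OF fin inj] m by (intro sum.cong) auto
  finally show ?thesis .
qed

text \<open>Uniqueness is inverting the Vandermonde system: reproducing \<open>z ^ j\<close> means that
  the matrix of coefficients of the Lagrange basis is a left inverse.\<close>
lemma interp_coef_eq:
  fixes h :: "real \<Rightarrow> 'a::banach"
  assumes inj: "inj_on (\<lambda>i. (t + c i * \<tau>) powr r) {1..\<nu>}"
  defines "x \<equiv> \<lambda>i. (t + c i * \<tau>) powr r"
  shows "interp_coef h r \<nu> c t \<tau> =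
    (\<lambda>m. \<Sum>i\<in>{1..\<nu>}. coeff (lagrange_basis x {1..\<nu>} i) m *\<^sub>R h (x i))" (is "_ = ?\<alpha>")
proof -
  have x_app: "(t + c i * \<tau>) powr r = x i" for i by (simp add: x_def)
  have inj': "inj_on x {1..\<nu>}" using inj by (simp add: x_def)
  have c0: "coeff (lagrange_basis x {1..\<nu>} i) m = 0" if "i \<in> {1..\<nu>}" "\<nu> \<le> m" for i m
    using degree_lagrange_basis_less[of "{1..\<nu>}" i x] that by (intro coeff_eq_0) auto
  have eval: "(\<Sum>j<\<nu>. z ^ j * coeff (lagrange_basis x {1..\<nu>} i) j) = poly (lagrange_basis x {1..\<nu>} i) z"
    if "i \<in> {1..\<nu>}" for i z
    using poly_lagrange_basis_coeff[of "{1..\<nu>}" i z x] that by simp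
  show ?thesis
    unfolding interp_coef_def x_app
  proof (rule the_equality, intro conjI allI impI ballI)
    fix m assume "m \<ge> \<nu>"
    then show "?\<alpha> m = 0" using c0 by (auto intro!: sum.neutral)
  next
    fix k assume k: "k \<in> {1..\<nu>}"
    have "(\<Sum>j<\<nu>. x k ^ j *\<^sub>R ?\<alpha> j)
        = (\<Sum>i\<in>{1..\<nu>}. (\<Sum>j<\<nu>. x k ^ j * coeff (lagrange_basis x {1..\<nu>} i) j) *\<^sub>R h (x i))"
      by (simp add: scaleR_sum_right scaleR_sum_left sum.swap[of _ "{..<\<nu>}"])
    also have "\<dots> = (\<Sum>i\<in>{1..\<nu>}. poly (lagrange_basis x {1..\<nu>} i) (x k) *\<^sub>R h (x i))"
      using eval by (intro sum.cong) auto
    also have "\<dots> = h (x k)" using inj' k by (intro sum_lagrange_basis_node) auto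
    finally show "(\<Sum>j<\<nu>. x k ^ j *\<^sub>R ?\<alpha> j) = h (x k)" .
  next
    fix \<beta> assume b: "(\<forall>j\<ge>\<nu>. \<beta> j = 0) \<and> (\<forall>i\<in>{1..\<nu>}. (\<Sum>j<\<nu>. x i ^ j *\<^sub>R \<beta> j) = h (x i))"
    show "\<beta> = ?\<alpha>"
    proof
      fix m
      have delta: "(\<Sum>i\<in>{1..\<nu>}. coeff (lagrange_basis x {1..\<nu>} i) m * x i ^ j) = (if j = m then 1 else 0)"
        if "j < \<nu>" for j
      proof -
        have "monom (1::real) j = (\<Sum>i\<in>{1..\<nu>}. smult (poly (monom 1 j) (x i)) (lagrange_basis x {1..\<nu>} i))"
          using inj' that by (intro lagrange_interpolation) (auto simp: degree_monom_eq)
        from arg_cong[OF this, of "\<lambda>p. coeff p m"] show ?thesis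
          by (simp add: coeff_sum poly_monom mult.commute)
      qed
      show "\<beta> m = ?\<alpha> m"
      proof (cases "m < \<nu>")
        case True
        have "?\<alpha> m = (\<Sum>i\<in>{1..\<nu>}. coeff (lagrange_basis x {1..\<nu>} i) m *\<^sub>R (\<Sum>j<\<nu>. x i ^ j *\<^sub>R \<beta> j))"
          using b by (intro sum.cong) auto
        also have "\<dots> = (\<Sum>j<\<nu>. (\<Sum>i\<in>{1..\<nu>}. coeff (lagrange_basis x {1..\<nu>} i) m * x i ^ j) *\<^sub>R \<beta> j)"
          by (simp add: scaleR_sum_right scaleR_sum_left sum.swap[of _ "{..<\<nu>}"])
        also have "\<dots> = (\<Sum>j<\<nu>. if m = j then \<beta> j else 0)"
          using delta by (intro sum.cong) auto
        also have "\<dots> = \<beta> m" using True by simp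
        finally show ?thesis by simp
      next
        case False
        then show ?thesis using b c0 by (auto intro!: sum.neutral[symmetric])
      qed
    qed
  qed
qed

text \<open>Passing to the Lagrange form means that the monomial coefficients are never estimated;
  only the interpolant's values enter the error analysis.\<close>

lemma interp_coef_poly:
  fixes h :: "real \<Rightarrow> 'a::banach"
  assumes inj: "inj_on (\<lambda>i. (t + c i * \<tau>) powr r) {1..\<nu>}"
  defines "x \<equiv> \<lambda>i. (t + c i * \<tau>) powr r"
  shows "(\<Sum>j<\<nu>. z ^ j *\<^sub>R interp_coef h r \<nu> c t \<tau> j) =
    (\<Sum>i\<in>{1..\<nu>}. poly (lagrange_basis x {1..\<nu>} i) z *\<^sub>R h (x i))"
proof -
  have eval: "(\<Sum>j<\<nu>. z ^ j * coeff (lagrange_basis x {1..\<nu>} i) j) = poly (lagrange_basis x {1..\<nu>} i) z"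
    if "i \<in> {1..\<nu>}" for i z
    using poly_lagrange_basis_coeff[of "{1..\<nu>}" i z x] that by simp
  have "(\<Sum>j<\<nu>. z ^ j *\<^sub>R interp_coef h r \<nu> c t \<tau> j) =
      (\<Sum>i\<in>{1..\<nu>}. (\<Sum>j<\<nu>. z ^ j * coeff (lagrange_basis x {1..\<nu>} i) j) *\<^sub>R h (x i))"
    using interp_coef_eq[OF inj, of h]
    by (simp add: x_def scaleR_sum_right scaleR_sum_left sum.swap[of _ "{..<\<nu>}"])
  also have "\<dots> = (\<Sum>i\<in>{1..\<nu>}. poly (lagrange_basis x {1..\<nu>} i) z *\<^sub>R h (x i))"
    using eval by (intro sum.cong) auto
  finally show ?thesis .
qed

section \<open>Taylor expansion with values in a Banach space\<close>

lemma taylor_remainder_bound: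
  fixes D :: "nat \<Rightarrow> real \<Rightarrow> 'a::banach"
  assumes p: "p > 0"
    and D: "\<And>k x. k < p \<Longrightarrow> 0 \<le> x \<Longrightarrow> (D k has_vector_derivative D (Suc k) x) (at x within {0..})"
    and K: "\<And>x. 0 \<le> x \<Longrightarrow> norm (D p x) \<le> K"
    and az: "0 \<le> a" "a \<le> z"
  shows "norm (D 0 z - (\<Sum>j<p. (z - a) ^ j *\<^sub>R ((1 / fact j) *\<^sub>R D j a))) \<le> K * (z - a) ^ p"
proof -
  let ?i = "\<lambda>x. ((z - x) ^ (p - 1) / fact (p - 1)) *\<^sub>R D p x"
  have "(?i has_integral D 0 z - (\<Sum>j<p. ((z - a) ^ j / fact j) *\<^sub>R D j a)) {a..z}"
    by (rule Taylor_has_integral[OF p refl])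
      (use az in \<open>auto intro: has_vector_derivative_within_subset[OF D]\<close>)
  moreover have "norm (?i x) \<le> (z - a) ^ (p - 1) * K" if "x \<in> cbox a z" for x
  proof -
    have "(z - x) ^ (p - 1) \<le> (z - a) ^ (p - 1)" using that by (intro power_mono) auto
    moreover have "1 \<le> (fact (p - 1) :: real)" by simp
    then have "(z - x) ^ (p - 1) / fact (p - 1) \<le> (z - x) ^ (p - 1)" 
      using that mult_left_mono[of 1 "fact (p - 1)" "(z - x) ^ (p - 1)"] 
      by (simp add: divide_le_eq)
    ultimately have "(z - x) ^ (p - 1) / fact (p - 1) \<le> (z - a) ^ (p - 1)" by linarith
    then have "(z - x) ^ (p - 1) / fact (p - 1) * norm (D p x) \<le> (z - a) ^ (p - 1) * K"
      using that az K[of x] by (intro mult_mono) auto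
    then show ?thesis using that by simp
  qed
  moreover have "0 \<le> K" using K[OF az(1)] norm_ge_zero order_trans by blast
  ultimately have "norm (D 0 z - (\<Sum>j<p. ((z - a) ^ j / fact j) *\<^sub>R D j a))
      \<le> (z - a) ^ (p - 1) * K * measure lborel (cbox a z)"
    using az by (intro has_integral_bound) auto
  also have "\<dots> = K * (z - a) ^ p"
    using az p by (cases p) auto
  finally show ?thesis by simp
qed

section \<open>Fractional powers at neighbouring points\<close>

lemma powr_diff_mean_value:
  fixes a b r :: real
  assumes "0 \<le> a" "a < b" "0 < r"
  obtains \<xi> where "a < \<xi>" "\<xi> < b" "b powr r - a powr r = r * \<xi> powr (r - 1) * (b - a)"
proof -
  have der: "((\<lambda>x. x powr r) has_real_derivative r * x powr (r - 1)) (at x)" if "a < x" for x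
    using has_real_derivative_powr[of x r] that assms by simp
  have "\<exists>l z. a < z \<and> z < b \<and> ((\<lambda>x. x powr r) has_real_derivative l) (at z) \<and>
      b powr r - a powr r = (b - a) * l"
  proof (rule MVT[OF assms(2)])
    show "continuous_on {a..b} (\<lambda>x. x powr r)"
      using assms by (intro continuous_on_powr' continuous_intros) auto
    show "(\<lambda>x. x powr r) differentiable (at x)" if "a < x" for x
      using der[OF that] real_differentiable_def by blast
  qed
  then show ?thesis using der DERIV_unique that by (metis mult.commute)
qed

text \<open>Up to the factor \<open>r\<close> this is the size of the derivative of x^r on [k, k+1].
  On [0, 1] the derivative is unbounded, but the increment of x^r is at most 1, which is the value
  that \<open>max\<close> assigns to \<open>k = 0\<close>.\<close>

definition step_scale :: "real \<Rightarrow> nat \<Rightarrow> real" where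
  "step_scale r k = max 1 (real k) powr (r - 1)"

lemma step_scale_pos: "step_scale r k > 0"
  by (simp add: step_scale_def)

lemma step_scale_power: "step_scale r k ^ n = max 1 (real k) powr ((r - 1) * real n)"
  by (simp add: step_scale_def powr_power mult.commute)

lemma step_scale_le_1: "r \<le> 1 \<Longrightarrow> step_scale r k \<le> 1"
  using powr_mono[of "r - 1" 0 "max 1 (real k)"] by (simp add: step_scale_def max_def split: if_splits)

text \<open>For \<open>k \<ge> 1\<close> the intermediate point lies in [k, k+1], so the derivative
  there differs from the one at \<open>k\<close> by a factor between 1/2 and 1 that is within 1/k of
  1. The lower bound separates the nodes, the upper one measures their spread, and the third makes
  the linearisation of the nodes quantitative.\<close>

lemma powr_node_diff_ordered:
  fixes r \<sigma> \<theta> :: real and k :: nat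
  assumes r: "0 < r" "r < 1" and st: "0 \<le> \<sigma>" "\<sigma> < \<theta>" "\<theta> \<le> 1"
  defines "d \<equiv> (real k + \<theta>) powr r - (real k + \<sigma>) powr r"
  shows "r / 2 * step_scale r k * (\<theta> - \<sigma>) \<le> d" "d \<le> step_scale r k"
    "\<bar>d - r * step_scale r k * (\<theta> - \<sigma>)\<bar> \<le> step_scale r k / max 1 (real k)"
proof -
  obtain \<xi> where \<xi>: "real k + \<sigma> < \<xi>" "\<xi> < real k + \<theta>"
    and d: "d = r * \<xi> powr (r - 1) * (\<theta> - \<sigma>)"
    using powr_diff_mean_value[of "real k + \<sigma>" "real k + \<theta>" r] st r unfolding d_def by auto
  have rt: "0 < r * (\<theta> - \<sigma>)" "r * (\<theta> - \<sigma>) \<le> 1"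
    using st r mult_mono[of r 1 "\<theta> - \<sigma>" 1] by auto
  show "r / 2 * step_scale r k * (\<theta> - \<sigma>) \<le> d" "d \<le> step_scale r k"
    "\<bar>d - r * step_scale r k * (\<theta> - \<sigma>)\<bar> \<le> step_scale r k / max 1 (real k)"
  proof (atomize (full), cases "k = 0")
    case True
    \<comment> \<open>In the first step the derivative is bounded only from below; the upper bound
      comes from \<theta>^r \<le> 1. As \<open>d\<close> and
      \<open>r * (\<theta> - \<sigma>)\<close> both lie in [0, 1], the third bound is immediate, its
      right-hand side being 1.\<close>
    have "1 \<le> \<xi> powr (r - 1)"
      using powr_mono2'[of "r - 1" \<xi> 1] \<xi> st r True by simp
    then have lo: "r * (\<theta> - \<sigma>) \<le> d" using d rt mult_left_mono[of 1 "\<xi> powr (r - 1)" "r * (\<theta> - \<sigma>)"]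
      by (simp add: mult_ac)
    have "\<theta> powr r \<le> 1" using powr_mono2[of r \<theta> 1] st r by simp
    then have hi: "d \<le> 1" using True unfolding d_def by (smt (verit) powr_ge_zero of_nat_0 add_0)
    show "r / 2 * step_scale r k * (\<theta> - \<sigma>) \<le> d \<and> d \<le> step_scale r k \<and>
      \<bar>d - r * step_scale r k * (\<theta> - \<sigma>)\<bar> \<le> step_scale r k / max 1 (real k)"
      using lo hi rt True by (simp add: step_scale_def)
  next
    case False
    then have k: "real k \<ge> 1" by simp
    define w where "w = step_scale r k"
    have w: "w = real k powr (r - 1)" "w > 0" using k by (auto simp: w_def step_scale_def)
    \<comment> \<open>\<open>\<rho>\<close> is the derivative of x^r at \<open>\<xi>\<close>
      relative to its value at \<open>k\<close>. Since \<open>k / \<xi> \<le> 1\<close> and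
      \<open>1 - r \<le> 1\<close>, it is at least \<open>k / \<xi>\<close>, which reduces both
      lower bounds on \<open>\<rho>\<close> to rational ones.\<close>
    define \<rho> where "\<rho> = (real k / \<xi>) powr (1 - r)"
    have x: "real k \<le> \<xi>" "\<xi> \<le> real k + 1" "\<xi> > 0" using \<xi> st k by auto
    have "\<rho> = real k powr (1 - r) / \<xi> powr (1 - r)"
      using x by (simp add: \<rho>_def powr_divide)
    also have "\<dots> = \<xi> powr (r - 1) / real k powr (r - 1)"
      using x k powr_minus_divide[of "real k" "r - 1"] powr_minus_divide[of \<xi> "r - 1"] by simp
    finally have dw: "d = w * (\<rho> * (r * (\<theta> - \<sigma>)))" using w k by (simp add: d)
    have "\<rho> \<le> 1" unfolding \<rho>_def using x r by (intro powr_le1) auto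
    have "real k / \<xi> \<le> \<rho>"
      using powr_mono'[of "1 - r" 1 "real k / \<xi>"] x r k by (simp add: \<rho>_def)
    moreover have "1 - 1 / real k \<le> real k / \<xi>"
    proof -
      have "\<xi> * (real k - 1) \<le> (real k + 1) * (real k - 1)" using x k by (intro mult_right_mono) auto
      also have "\<dots> \<le> real k * real k" by (simp add: algebra_simps)
      finally show ?thesis using x k by (simp add: field_simps)
    qed
    moreover have "1 / 2 \<le> real k / \<xi>" using x k by (simp add: field_simps)
    ultimately have \<rho>: "1 / 2 \<le> \<rho>" "\<rho> \<le> 1" "1 - \<rho> \<le> 1 / real k" using \<open>\<rho> \<le> 1\<close> by linarith+
    have "1 / 2 * (r * (\<theta> - \<sigma>)) \<le> \<rho> * (r * (\<theta> - \<sigma>))" using \<rho> rt by (intro mult_right_mono) auto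
    then have 1: "w * (1 / 2 * (r * (\<theta> - \<sigma>))) \<le> d" unfolding dw using w by (intro mult_left_mono) auto
    have "\<rho> * (r * (\<theta> - \<sigma>)) \<le> 1" using mult_le_one[OF \<rho>(2) _ rt(2)] rt(1) by linarith
    then have 2: "d \<le> w" unfolding dw using w by simp
    have "(1 - \<rho>) * (r * (\<theta> - \<sigma>)) \<le> 1 / real k * 1" using \<rho> rt by (intro mult_mono) auto
    then have "w * ((1 - \<rho>) * (r * (\<theta> - \<sigma>))) \<le> w * (1 / real k)"
      using w by (intro mult_left_mono) auto
    moreover have "\<bar>d - r * w * (\<theta> - \<sigma>)\<bar> = w * ((1 - \<rho>) * (r * (\<theta> - \<sigma>)))"
    proof -
      have "d - r * w * (\<theta> - \<sigma>) = - (w * ((1 - \<rho>) * (r * (\<theta> - \<sigma>))))" unfolding dw by (simp add: algebra_simps)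
      moreover have "0 \<le> w * ((1 - \<rho>) * (r * (\<theta> - \<sigma>)))"
        using w \<rho> r st by (intro mult_nonneg_nonneg) auto
      ultimately show ?thesis by simp
    qed
    ultimately have 3: "\<bar>d - r * w * (\<theta> - \<sigma>)\<bar> \<le> w / max 1 (real k)" using k by simp
    show "r / 2 * step_scale r k * (\<theta> - \<sigma>) \<le> d \<and> d \<le> step_scale r k \<and>
      \<bar>d - r * step_scale r k * (\<theta> - \<sigma>)\<bar> \<le> step_scale r k / max 1 (real k)"
      using 1 2 3 unfolding w_def[symmetric] by (simp add: mult_ac)
  qed
qed

lemma powr_node_diff:
  fixes r \<sigma> \<theta> :: real and k :: nat
  assumes r: "0 < r" "r < 1" and st: "\<sigma> \<in> {0..1}" "\<theta> \<in> {0..1}"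
  defines "d \<equiv> (real k + \<theta>) powr r - (real k + \<sigma>) powr r"
  shows "r / 2 * step_scale r k * \<bar>\<theta> - \<sigma>\<bar> \<le> \<bar>d\<bar>" "\<bar>d\<bar> \<le> step_scale r k"
    "\<bar>d - r * step_scale r k * (\<theta> - \<sigma>)\<bar> \<le> step_scale r k / max 1 (real k)"
proof -
  have w: "step_scale r k > 0" by (rule step_scale_pos)
  have "r / 2 * step_scale r k * \<bar>\<theta> - \<sigma>\<bar> \<le> \<bar>d\<bar> \<and> \<bar>d\<bar> \<le> step_scale r k \<and>
    \<bar>d - r * step_scale r k * (\<theta> - \<sigma>)\<bar> \<le> step_scale r k / max 1 (real k)"
  proof (cases \<sigma> \<theta> rule: linorder_cases)
    case less
    note b = powr_node_diff_ordered[OF r _ less, of k, folded d_def]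
    have "0 \<le> r / 2 * step_scale r k * (\<theta> - \<sigma>)" using w less r by simp
    then show ?thesis using b st less by auto
  next
    case equal
    then show ?thesis using w by (simp add: d_def)
  next
    case greater
    have d': "(real k + \<sigma>) powr r - (real k + \<theta>) powr r = - d" by (simp add: d_def)
    note b = powr_node_diff_ordered[OF r _ greater, of k, unfolded d']
    have "0 \<le> r / 2 * step_scale r k * (\<sigma> - \<theta>)" using w greater r by simp
    moreover have "- d - r * step_scale r k * (\<sigma> - \<theta>) = - (d - r * step_scale r k * (\<theta> - \<sigma>))"
      by (simp add: algebra_simps)
    ultimately show ?thesis using b st greater by auto
  qed
  then show "r / 2 * step_scale r k * \<bar>\<theta> - \<sigma>\<bar> \<le> \<bar>d\<bar>" "\<bar>d\<bar> \<le> step_scale r k"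
    "\<bar>d - r * step_scale r k * (\<theta> - \<sigma>)\<bar> \<le> step_scale r k / max 1 (real k)" by auto
qed

section \<open>Sums of powers of the step index\<close>

lemma sum_powr_bounded:
  assumes "a < -1"
  shows "\<exists>C. \<forall>N. (\<Sum>k<N. max 1 (real k) powr a) \<le> C"
proof -
  have s: "summable (\<lambda>k. real k powr a)" using assms summable_real_powr_iff by auto
  have "(\<Sum>k<N. max 1 (real k) powr a) \<le> 1 + suminf (\<lambda>k. real k powr a)" for N
  proof -
    \<comment> \<open>Only the term \<open>k = 0\<close> differs from the summable series: it equals
      1 here, whereas \<open>0 powr a\<close> is 0.\<close>
    have "(\<Sum>k<N. max 1 (real k) powr a) \<le> (\<Sum>k<N. (if k = 0 then 1 else 0) + real k powr a)"
      by (intro sum_mono) (auto simp: max_def)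
    also have "\<dots> = (\<Sum>k<N. if k = 0 then 1 else 0) + (\<Sum>k<N. real k powr a)" by (rule sum.distrib)
    also have "\<dots> \<le> 1 + suminf (\<lambda>k. real k powr a)"
      using s by (intro add_mono sum_le_suminf) (auto simp: sum.delta)
    finally show ?thesis .
  qed
  then show ?thesis by blast
qed

lemma sum_powr_le:
  assumes "-1 < a" "a \<le> 0" "N > 0"
  shows "(\<Sum>k<N. max 1 (real k) powr a) \<le> (1 + 1 / (a + 1)) * real N powr (a + 1)"
proof -
  have "(\<Sum>k<Suc n. max 1 (real k) powr a) \<le> 1 + real n powr (a + 1) / (a + 1)" for n
  proof (induction n)
    case (Suc n)
    obtain \<xi> where \<xi>: "real n < \<xi>" "\<xi> < real n + 1"
      "(real n + 1) powr (a + 1) - real n powr (a + 1) = (a + 1) * \<xi> powr a * 1"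
      using powr_diff_mean_value[of "real n" "real n + 1" "a + 1"] assms by auto
    \<comment> \<open>As \<open>a \<le> 0\<close>, the term at the right end of [n, n+1] is below
      the derivative at \<open>\<xi>\<close>, hence below the increment of x^(a+1)/(a+1). This is
      the integral comparison, and it telescopes.\<close>
    have "(real n + 1) powr a \<le> \<xi> powr a" using \<xi> assms by (intro powr_mono2') auto
    also have "\<dots> = (real n + 1) powr (a + 1) / (a + 1) - real n powr (a + 1) / (a + 1)"
      unfolding diff_divide_distrib[symmetric] \<xi>(3) using assms by simp
    finally have "max 1 (real (Suc n)) powr a \<le> real (Suc n) powr (a + 1) / (a + 1) - real n powr (a + 1) / (a + 1)"
      by (simp add: add.commute max_def)
    then show ?case using Suc by (subst sum.lessThan_Suc) linarith
  qed simp
  from this[of "N - 1"] have "(\<Sum>k<N. max 1 (real k) powr a) \<le> 1 + real (N - 1) powr (a + 1) / (a + 1)"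
    using assms by simp
  also have "\<dots> \<le> real N powr (a + 1) + real N powr (a + 1) / (a + 1)"
    using assms by (intro add_mono divide_right_mono powr_mono2 ge_one_powr_ge_zero) auto
  finally show ?thesis by (simp add: algebra_simps)
qed

text \<open>Increments of the logarithm dominate the reciprocals from \<open>k = 2\<close> on; the
  constant 2 consists of the terms \<open>k = 0\<close> and \<open>k = 1\<close>, both equal to
  1.\<close>

lemma sum_inverse_le:
  assumes "N > 0"
  shows "(\<Sum>k<N. max 1 (real k) powr -1) \<le> 2 + ln (real N)"
proof -
  have "(\<Sum>k<Suc (Suc n). max 1 (real k) powr -1) \<le> 2 + ln (real (Suc n))" for n
  proof (induction n)
    case (Suc n)
    have "ln (real (Suc n) / real (Suc (Suc n))) \<le> real (Suc n) / real (Suc (Suc n)) - 1"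
      by (rule ln_le_minus_one) simp
    then have "1 / real (Suc (Suc n)) \<le> ln (real (Suc (Suc n))) - ln (real (Suc n))"
      by (simp add: ln_div field_simps)
    moreover have "max 1 (real (Suc (Suc n))) powr -1 = 1 / real (Suc (Suc n))"
      by (simp add: powr_minus_divide)
    ultimately show ?case using Suc by (subst sum.lessThan_Suc) linarith
  qed simp
  from this[of "N - 1"] have "(\<Sum>k<Suc N. max 1 (real k) powr -1) \<le> 2 + ln (real N)"
    using assms by simp
  moreover have "(\<Sum>k<N. max 1 (real k) powr -1) \<le> (\<Sum>k<Suc N. max 1 (real k) powr -1)"
    by simp
  ultimately show ?thesis by linarith
qed

section \<open>Local defects of the scheme\<close>

text \<open>For a non-integrable \<open>f\<close> both integrals take the default value 0, so the
  substitution carries no side condition. This is convenient for weights such as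
  \<open>s powr (lam - 1)\<close> that may be singular at 0.\<close>

lemma integral_unit_scale:
  fixes f :: "real \<Rightarrow> 'a::banach"
  assumes \<tau>: "\<tau> > 0"
  shows "integral {a..a + \<tau>} f = \<tau> *\<^sub>R integral {0..1} (\<lambda>\<theta>. f (a + \<theta> * \<tau>))"
proof -
  have iff: "((\<lambda>\<theta>. f (a + \<theta> * \<tau>)) has_integral I /\<^sub>R \<tau>) {0..1} \<longleftrightarrow> (f has_integral I) {a..a + \<tau>}" for I
    using has_integral_affinity_iff[of \<tau> f a I a "a + \<tau>"] \<tau> by (simp add: mult.commute add.commute)
  show ?thesis
  proof (cases "f integrable_on {a..a + \<tau>}")
    case True
    then have "((\<lambda>\<theta>. f (a + \<theta> * \<tau>)) has_integral integral {a..a + \<tau>} f /\<^sub>R \<tau>) {0..1}"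
      unfolding iff by (rule integrable_integral)
    then show ?thesis using \<tau> by (simp add: integral_unique)
  next
    case False
    then have "\<not> (\<lambda>\<theta>. f (a + \<theta> * \<tau>)) integrable_on {0..1}"
      using iff[of "\<tau> *\<^sub>R _"] \<tau> by (auto simp: integrable_on_def)
    then show ?thesis using False by (simp add: not_integrable_integral)
  qed
qed

text \<open>The substitution s = \<theta>t turns the \<phi> function into a convolution over {0..t}.
  At \<open>t = 0\<close> both sides vanish because \<open>0 powr lam = 0\<close>, which is the
  convention used in the first step of the scheme.\<close>

lemma phi_eq_convolution:
  fixes S :: "real \<Rightarrow> 'a::banach \<Rightarrow>\<^sub>L 'a"
  assumes t: "0 \<le> t" and lam: "lam > 0"
  shows "Gamma lam *\<^sub>R t powr lam *\<^sub>R phi S lam t v = integral {0..t} (\<lambda>s. s powr (lam - 1) *\<^sub>R S (t - s) v)"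
proof (cases "t = 0")
  case False
  with t have t0: "t > 0" by simp
  have "integral {0..t} (\<lambda>s. s powr (lam - 1) *\<^sub>R S (t - s) v)
      = t *\<^sub>R integral {0..1} (\<lambda>\<theta>. (\<theta> * t) powr (lam - 1) *\<^sub>R S (t - \<theta> * t) v)"
    using integral_unit_scale[OF t0, of 0 "\<lambda>s. s powr (lam - 1) *\<^sub>R S (t - s) v"] by simp
  also have "(\<lambda>\<theta>. (\<theta> * t) powr (lam - 1) *\<^sub>R S (t - \<theta> * t) v) =
      (\<lambda>\<theta>. t powr (lam - 1) *\<^sub>R \<theta> powr (lam - 1) *\<^sub>R S ((1 - \<theta>) * t) v)"
    by (simp add: powr_mult algebra_simps)
  also have "t *\<^sub>R integral {0..1} \<dots> = (t * t powr (lam - 1)) *\<^sub>R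
      integral {0..1} (\<lambda>\<theta>. \<theta> powr (lam - 1) *\<^sub>R S ((1 - \<theta>) * t) v)"
    by (subst integral_cmul) simp
  also have "t * t powr (lam - 1) = t powr lam"
    using t0 by (simp add: powr_diff)
  finally show ?thesis
    using Gamma_real_pos[OF lam] by (simp add: phi_def)
qed simp

lemma c0_semigroup_convolution_integrable:
  fixes S :: "real \<Rightarrow> 'a::banach \<Rightarrow>\<^sub>L 'a"
  assumes "c0_semigroup S" "continuous_on {a..b} f" "b \<le> t"
  shows "(\<lambda>s. S (t - s) (f s)) integrable_on {a..b}"
  using assms
  by (intro integrable_continuous_interval c0_semigroup_continuous_on_compose continuous_intros) auto

text \<open>By the semigroup law the integrand on {0..t} is \<open>S \<tau>\<close> applied to the
  earlier one, and a bounded operator passes through the integral. What the last step adds is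
  therefore a difference of two convolutions starting at 0, the shape in which the scheme is
  written.\<close>

lemma c0_semigroup_convolution_step:
  fixes S :: "real \<Rightarrow> 'a::banach \<Rightarrow>\<^sub>L 'a"
  assumes sg: "c0_semigroup S" and f: "continuous_on {0..t + \<tau>} f" and t: "0 \<le> t" "0 \<le> \<tau>"
  shows "integral {0..t + \<tau>} (\<lambda>s. S (t + \<tau> - s) (f s)) =
    S \<tau> (integral {0..t} (\<lambda>s. S (t - s) (f s))) + integral {t..t + \<tau>} (\<lambda>s. S (t + \<tau> - s) (f s))"
proof -
  have int: "(\<lambda>s. S (t + \<tau> - s) (f s)) integrable_on {0..t + \<tau>}"
    by (rule c0_semigroup_convolution_integrable[OF sg f]) simp
  have int': "(\<lambda>s. S (t - s) (f s)) integrable_on {0..t}"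
    by (rule c0_semigroup_convolution_integrable[OF sg continuous_on_subset[OF f]]) (use t in auto)
  have "integral {0..t} (\<lambda>s. S (t + \<tau> - s) (f s)) = integral {0..t} (\<lambda>s. S \<tau> (S (t - s) (f s)))"
  proof (rule integral_cong)
    fix s assume "s \<in> {0..t}"
    then show "S (t + \<tau> - s) (f s) = S \<tau> (S (t - s) (f s))"
      using c0_semigroup_add[OF sg, of \<tau> "t - s" "f s"] t by (simp add: algebra_simps)
  qed
  also have "\<dots> = S \<tau> (integral {0..t} (\<lambda>s. S (t - s) (f s)))"
    by (rule integral_blinfun_apply[OF int'])
  finally show ?thesis
    using Henstock_Kurzweil_Integration.integral_combine[OF _ _ int, of t] t by simp
qed

lemma mild_sol_step:
  fixes S :: "real \<Rightarrow> 'a::banach \<Rightarrow>\<^sub>L 'a"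
  assumes sg: "c0_semigroup S" and h: "continuous_on {0..} h" and r: "0 < r" and t: "0 \<le> t" "0 \<le> \<tau>"
  shows "mild_sol S h r y0 (t + \<tau>) = S \<tau> (mild_sol S h r y0 t)
    + integral {t..t + \<tau>} (\<lambda>s. S (t + \<tau> - s) (h (s powr r)))"
proof -
  have "continuous_on {0..t + \<tau>} (\<lambda>s. h (s powr r))"
    using r by (intro continuous_on_compose2[OF h] continuous_on_powr' continuous_intros) auto
  from c0_semigroup_convolution_step[OF sg this t] show ?thesis
    using c0_semigroup_add[OF sg t(2) t(1), of y0]
    by (simp add: mild_sol_def blinfun.add_right add.commute)
qed

text \<open>Each bracket of \<phi> functions is such a difference of convolutions from 0, so the
  history before \<open>t n\<close> cancels. The scheme is thus the variation-of-constants step with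
  the interpolant as exact source term.\<close>

lemma eqrf_step:
  fixes S :: "real \<Rightarrow> 'a::banach \<Rightarrow>\<^sub>L 'a" and h :: "real \<Rightarrow> 'a" and c :: "nat \<Rightarrow> real"
  assumes sg: "c0_semigroup S" and r: "0 < r" and \<tau>: "0 < \<tau>" and nu: "\<nu> \<ge> 1"
  defines "t \<equiv> \<lambda>n. real n * \<tau>" and "\<alpha> \<equiv> \<lambda>n. interp_coef h r \<nu> c (real n * \<tau>) \<tau>"
  shows "eqrf S h r \<nu> c \<tau> y0 (Suc n) = S \<tau> (eqrf S h r \<nu> c \<tau> y0 n)
    + integral {t n..t n + \<tau>} (\<lambda>s. S (t n + \<tau> - s) (\<Sum>j<\<nu>. (s powr r) ^ j *\<^sub>R \<alpha> n j))"
proof -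
  have t0: "0 \<le> t n" using \<tau> by (simp add: t_def)
  have cont: "continuous_on A (\<lambda>s. (s powr r) ^ j *\<^sub>R \<alpha> n j)" if "A \<subseteq> {0..}" for A j
    using r that by (intro continuous_intros continuous_on_powr') auto
  have int: "(\<lambda>s. S (t n + \<tau> - s) ((s powr r) ^ j *\<^sub>R \<alpha> n j)) integrable_on {t n..t n + \<tau>}" for j
    by (rule c0_semigroup_convolution_integrable[OF sg cont]) (use t0 in auto)
  have conv: "Gamma (1 + real j * r) *\<^sub>R u powr (1 + real j * r) *\<^sub>R phi S (1 + real j * r) u (\<alpha> n j)
      = integral {0..u} (\<lambda>s. S (u - s) ((s powr r) ^ j *\<^sub>R \<alpha> n j))" if "0 \<le> u" "j \<ge> 1" for u j
  proof -
    \<comment> \<open>At \<open>s = 0\<close> this requires \<open>j \<ge> 1\<close>, since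
      \<open>0 ^ 0\<close> is 1 but \<open>0 powr 0\<close> is 0. The constant term is therefore
      treated separately below.\<close>
    have "(s powr r) ^ j = s powr (real j * r)" for s :: real
      using that by (cases "s = 0") (auto simp: powr_power)
    then show ?thesis
      using phi_eq_convolution[of u "1 + real j * r" S] that r
      by (simp add: add_pos_nonneg blinfun.scaleR_right)
  qed
  have "Gamma (1 + real j * r) *\<^sub>R
            ((t n + \<tau>) powr (1 + real j * r) *\<^sub>R phi S (1 + real j * r) (t n + \<tau>) (\<alpha> n j)
             - t n powr (1 + real j * r) *\<^sub>R S \<tau> (phi S (1 + real j * r) (t n) (\<alpha> n j)))
      = integral {t n..t n + \<tau>} (\<lambda>s. S (t n + \<tau> - s) ((s powr r) ^ j *\<^sub>R \<alpha> n j))"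
    (is "?l j = _") if j: "j \<in> {1..<\<nu>}" for j
  proof -
    have j1: "j \<ge> 1" using j by simp
    have "?l j = Gamma (1 + real j * r) *\<^sub>R (t n + \<tau>) powr (1 + real j * r) *\<^sub>R phi S (1 + real j * r) (t n + \<tau>) (\<alpha> n j)
      - S \<tau> (Gamma (1 + real j * r) *\<^sub>R t n powr (1 + real j * r) *\<^sub>R phi S (1 + real j * r) (t n) (\<alpha> n j))"
      by (simp add: blinfun.scaleR_right scaleR_diff_right)
    also have "\<dots> = integral {t n..t n + \<tau>} (\<lambda>s. S (t n + \<tau> - s) ((s powr r) ^ j *\<^sub>R \<alpha> n j))"
      using t0 \<tau> j1 c0_semigroup_convolution_step[OF sg cont, of "t n" \<tau> j]
      by (simp only: conv[OF t0 j1] conv[OF _ j1, of "t n + \<tau>"]) simp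
    finally show ?thesis .
  qed
  then have higher: "(\<Sum>j\<in>{1..<\<nu>}. ?l j)
      = (\<Sum>j\<in>{1..<\<nu>}. integral {t n..t n + \<tau>} (\<lambda>s. S (t n + \<tau> - s) ((s powr r) ^ j *\<^sub>R \<alpha> n j)))"
    by (rule sum.cong[OF refl])
  have zero: "\<tau> *\<^sub>R phi S 1 \<tau> (\<alpha> n 0) = integral {t n..t n + \<tau>} (\<lambda>s. S (t n + \<tau> - s) ((s powr r) ^ 0 *\<^sub>R \<alpha> n 0))"
  proof -
    have "\<tau> *\<^sub>R phi S 1 \<tau> (\<alpha> n 0) = integral {0..\<tau>} (\<lambda>s. s powr 0 *\<^sub>R S (\<tau> - s) (\<alpha> n 0))"
      using phi_eq_convolution[of \<tau> 1 S] \<tau> by simp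
    \<comment> \<open>The weight \<open>s powr 0\<close> is 1 except at \<open>s = 0\<close>, where
      it is 0; a single point does not affect the integral. The shift from {0..\<tau>} to the
      current step then uses that the remaining integrand depends on the remaining time
      only.\<close>
    also have "\<dots> = integral {0..\<tau>} (\<lambda>s. S (\<tau> - s) (\<alpha> n 0))"
      by (rule integral_spike[of "{0}"]) auto
    also have "\<dots> = integral {t n..t n + \<tau>} (\<lambda>s. S (t n + \<tau> - s) (\<alpha> n 0))"
      using integral_unit_scale[OF \<tau>, of 0 "\<lambda>s. S (\<tau> - s) (\<alpha> n 0)"]
        integral_unit_scale[OF \<tau>, of "t n" "\<lambda>s. S (t n + \<tau> - s) (\<alpha> n 0)"]
      by (simp add: add.commute)
    finally show ?thesis by simp
  qed
  have "{..<\<nu>} = insert 0 {1..<\<nu>}" using nu by auto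
  then have "\<tau> *\<^sub>R phi S 1 \<tau> (\<alpha> n 0) + (\<Sum>j\<in>{1..<\<nu>}. ?l j)
      = (\<Sum>j<\<nu>. integral {t n..t n + \<tau>} (\<lambda>s. S (t n + \<tau> - s) ((s powr r) ^ j *\<^sub>R \<alpha> n j)))"
    unfolding zero higher by simp
  also have "\<dots> = integral {t n..t n + \<tau>} (\<lambda>s. \<Sum>j<\<nu>. S (t n + \<tau> - s) ((s powr r) ^ j *\<^sub>R \<alpha> n j))"
    by (rule integral_sum[symmetric]) (use int in auto)
  also have "\<dots> = integral {t n..t n + \<tau>} (\<lambda>s. S (t n + \<tau> - s) (\<Sum>j<\<nu>. (s powr r) ^ j *\<^sub>R \<alpha> n j))"
    by (simp add: blinfun.sum_right)
  finally show ?thesis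
    by (simp add: Let_def t_def \<alpha>_def add.assoc)
qed

section \<open>Recursion and accumulation of the error\<close>

definition node :: "real \<Rightarrow> real \<Rightarrow> nat \<Rightarrow> real \<Rightarrow> real" where
  "node r \<tau> k \<theta> = (real k * \<tau> + \<theta> * \<tau>) powr r"

definition interp_error :: "(real \<Rightarrow> 'a::banach) \<Rightarrow> real \<Rightarrow> nat \<Rightarrow> (nat \<Rightarrow> real) \<Rightarrow> real \<Rightarrow> nat \<Rightarrow> real \<Rightarrow> 'a" where
  "interp_error h r \<nu> c \<tau> k \<theta> = h (node r \<tau> k \<theta>)
     - (\<Sum>j<\<nu>. node r \<tau> k \<theta> ^ j *\<^sub>R interp_coef h r \<nu> c (real k * \<tau>) \<tau> j)"

lemma continuous_on_interp_error:
  assumes h: "continuous_on {0..} h" and "0 < r" "0 \<le> \<tau>"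
  shows "continuous_on {0..1} (interp_error h r \<nu> c \<tau> k)"
proof -
  have n: "continuous_on {0..1} (node r \<tau> k)"
    unfolding node_def using assms by (intro continuous_on_powr' continuous_intros) auto
  show ?thesis
    unfolding interp_error_def
    by (intro continuous_intros n continuous_on_compose2[OF h n]) (auto simp: node_def)
qed

lemma eqrf_error_step:
  fixes S :: "real \<Rightarrow> 'a::banach \<Rightarrow>\<^sub>L 'a" and c :: "nat \<Rightarrow> real" and y0 :: 'a
  assumes sg: "c0_semigroup S" and h: "continuous_on {0..} h" and r: "0 < r" and \<tau>: "0 < \<tau>" and nu: "\<nu> \<ge> 1"
  defines "err \<equiv> \<lambda>n. mild_sol S h r y0 (real n * \<tau>) - eqrf S h r \<nu> c \<tau> y0 n"
  shows "err (Suc n) = S \<tau> (err n) + \<tau> *\<^sub>R integral {0..1} (\<lambda>\<theta>. S ((1 - \<theta>) * \<tau>) (interp_error h r \<nu> c \<tau> n \<theta>))"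
proof -
  define t where "t = real n * \<tau>"
  define p where "p s = (\<Sum>j<\<nu>. (s powr r) ^ j *\<^sub>R interp_coef h r \<nu> c t \<tau> j)" for s
  have t0: "0 \<le> t" using \<tau> by (simp add: t_def)
  have st: "real (Suc n) * \<tau> = t + \<tau>" by (simp add: t_def algebra_simps)
  have c1: "continuous_on {t..t + \<tau>} (\<lambda>s. h (s powr r))"
    using r t0 by (intro continuous_on_compose2[OF h] continuous_on_powr' continuous_intros) auto
  have c2: "continuous_on {t..t + \<tau>} p"
    unfolding p_def using r t0 by (intro continuous_intros continuous_on_powr') auto
  have "err (Suc n) = S \<tau> (err n) + (integral {t..t + \<tau>} (\<lambda>s. S (t + \<tau> - s) (h (s powr r)))
      - integral {t..t + \<tau>} (\<lambda>s. S (t + \<tau> - s) (p s)))"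
    using mild_sol_step[OF sg h r t0, of \<tau> y0] eqrf_step[OF sg r \<tau> nu, of h c y0 n] \<tau>
    unfolding err_def st
    by (simp only: t_def[symmetric] p_def[symmetric] blinfun.diff_right less_imp_le) simp
  also have "integral {t..t + \<tau>} (\<lambda>s. S (t + \<tau> - s) (h (s powr r))) - integral {t..t + \<tau>} (\<lambda>s. S (t + \<tau> - s) (p s))
      = integral {t..t + \<tau>} (\<lambda>s. S (t + \<tau> - s) (h (s powr r)) - S (t + \<tau> - s) (p s))"
    by (intro integral_diff[symmetric] c0_semigroup_convolution_integrable sg c1 c2) auto
  also have "\<dots> = \<tau> *\<^sub>R integral {0..1} (\<lambda>\<theta>. S ((1 - \<theta>) * \<tau>) (interp_error h r \<nu> c \<tau> n \<theta>))"
    unfolding integral_unit_scale[OF \<tau>] interp_error_def node_def p_def t_def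
    by (simp add: blinfun.diff_right left_diff_distrib)
  finally show ?thesis .
qed

text \<open>Estimating step by step would produce the factor M^n. Instead each defect is transported
  by one operator \<open>S (real j * \<tau>)\<close> with total time at most \<open>T\<close>, so a
  single \<open>M\<close> suffices. For the induction, the claim is strengthened to the error
  propagated through \<open>j\<close> further steps.\<close>

lemma c0_semigroup_error_accumulation:
  fixes S :: "real \<Rightarrow> 'a::banach \<Rightarrow>\<^sub>L 'a"
  assumes sg: "c0_semigroup S" and M: "\<And>t x. 0 \<le> t \<Longrightarrow> t \<le> T \<Longrightarrow> norm (S t x) \<le> M * norm x"
    and \<tau>: "0 \<le> \<tau>" and T: "real N * \<tau> \<le> T"
    and e0: "e 0 = 0" and step: "\<And>n. n < N \<Longrightarrow> e (Suc n) = S \<tau> (e n) + d n"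
    and n: "n \<le> N"
  shows "norm (e n) \<le> M * (\<Sum>k<n. norm (d k))"
proof -
  have "norm (S (real j * \<tau>) (e n)) \<le> M * (\<Sum>k<n. norm (d k))" if "n + j \<le> N" for n j
    using that
  proof (induction n arbitrary: j)
    case 0
    then show ?case by (simp add: e0 blinfun.zero_right)
  next
    case (Suc n)
    have "real j * \<tau> \<le> real N * \<tau>" using Suc.prems \<tau> by (intro mult_right_mono) auto
    then have "norm (S (real j * \<tau>) (d n)) \<le> M * norm (d n)" using T \<tau> by (intro M) auto
    moreover have "S (real j * \<tau>) (e (Suc n)) = S (real (Suc j) * \<tau>) (e n) + S (real j * \<tau>) (d n)"
      using step[of n] Suc.prems c0_semigroup_add[OF sg, of "real j * \<tau>" \<tau> "e n"] \<tau>
      by (simp add: blinfun.add_right algebra_simps)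
    moreover have "norm (S (real (Suc j) * \<tau>) (e n)) \<le> M * (\<Sum>k<n. norm (d k))"
      using Suc.IH[of "Suc j"] Suc.prems by simp
    ultimately show ?case
      using norm_triangle_ineq[of "S (real (Suc j) * \<tau>) (e n)" "S (real j * \<tau>) (d n)"]
      by (simp add: algebra_simps)
  qed
  from this[of n 0] n show ?thesis by (simp add: c0_semigroup_0[OF sg])
qed

section \<open>Uniform interpolation error bounds\<close>

definition step_width :: "real \<Rightarrow> real \<Rightarrow> nat \<Rightarrow> real" where
  "step_width r \<tau> k = \<tau> powr r * step_scale r k"

lemma step_width_pos: "0 < \<tau> \<Longrightarrow> step_width r \<tau> k > 0"
  by (simp add: step_width_def step_scale_pos)

lemma step_width_power:
  assumes "0 < \<tau>"
  shows "step_width r \<tau> k ^ n = \<tau> powr (real n * r) * max 1 (real k) powr ((r - 1) * real n)"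
  using assms by (simp add: step_width_def power_mult_distrib step_scale_power powr_power)

lemma node_diff:
  fixes r \<tau> \<theta> \<sigma> :: real and k :: nat
  assumes r: "0 < r" "r < 1" and \<tau>: "0 < \<tau>" and st: "\<sigma> \<in> {0..1}" "\<theta> \<in> {0..1}"
  defines "d \<equiv> node r \<tau> k \<theta> - node r \<tau> k \<sigma>"
  shows "r / 2 * step_width r \<tau> k * \<bar>\<theta> - \<sigma>\<bar> \<le> \<bar>d\<bar>" "\<bar>d\<bar> \<le> step_width r \<tau> k"
    "\<bar>d - r * step_width r \<tau> k * (\<theta> - \<sigma>)\<bar> \<le> step_width r \<tau> k / max 1 (real k)"
proof -
  define \<delta> where "\<delta> = (real k + \<theta>) powr r - (real k + \<sigma>) powr r"
  have d: "d = \<tau> powr r * \<delta>"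
    unfolding d_def node_def \<delta>_def distrib_right[symmetric] powr_mult by (simp add: algebra_simps)
  note b = powr_node_diff[OF r st, of k, folded \<delta>_def]
  have p: "0 \<le> \<tau> powr r" by simp
  have "\<tau> powr r * (r / 2 * step_scale r k * \<bar>\<theta> - \<sigma>\<bar>) \<le> \<tau> powr r * \<bar>\<delta>\<bar>"
    by (rule mult_left_mono[OF b(1) p])
  then show "r / 2 * step_width r \<tau> k * \<bar>\<theta> - \<sigma>\<bar> \<le> \<bar>d\<bar>"
    by (simp add: d step_width_def abs_mult mult_ac)
  show "\<bar>d\<bar> \<le> step_width r \<tau> k"
    using mult_left_mono[OF b(2) p] by (simp add: d step_width_def abs_mult)
  have "\<tau> powr r * \<bar>\<delta> - r * step_scale r k * (\<theta> - \<sigma>)\<bar> \<le> \<tau> powr r * (step_scale r k / max 1 (real k))"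
    by (rule mult_left_mono[OF b(3) p])
  moreover have "d - r * step_width r \<tau> k * (\<theta> - \<sigma>) = \<tau> powr r * (\<delta> - r * step_scale r k * (\<theta> - \<sigma>))"
    by (simp add: d step_width_def algebra_simps)
  ultimately show "\<bar>d - r * step_width r \<tau> k * (\<theta> - \<sigma>)\<bar> \<le> step_width r \<tau> k / max 1 (real k)"
    by (simp add: step_width_def abs_mult)
qed

lemma node_nonneg: "0 \<le> node r \<tau> k \<theta>"
  by (simp add: node_def)

lemma node_mono:
  assumes "0 \<le> r" "0 \<le> \<tau>" "0 \<le> \<sigma>" "\<sigma> \<le> \<theta>"
  shows "node r \<tau> k \<sigma> \<le> node r \<tau> k \<theta>"
  unfolding node_def using assms by (intro powr_mono2 add_mono mult_right_mono) auto

lemma inj_on_node: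
  assumes r: "0 < r" "r < 1" and \<tau>: "0 < \<tau>" and c: "\<forall>i\<in>I. c i \<in> {0..1}" "inj_on c I"
  shows "inj_on (\<lambda>i. node r \<tau> k (c i)) I"
proof (rule inj_onI)
  fix i j assume ij: "i \<in> I" "j \<in> I" "node r \<tau> k (c i) = node r \<tau> k (c j)"
  then have "r / 2 * step_width r \<tau> k * \<bar>c i - c j\<bar> \<le> 0"
    using node_diff(1)[OF r \<tau>, of "c j" "c i" k] c by simp
  then have "c i = c j"
    using r step_width_pos[OF \<tau>, of r k] by (simp add: mult_le_0_iff)
  then show "i = j" using c ij by (auto dest: inj_onD)
qed

text \<open>Each factor of a Lagrange basis polynomial is a spread of at most w divided by a node
  distance of at least r/2 * w * |c i - c j|. The width w cancels, so this bound on the Lebesgue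
  constant involves neither the step index nor \<tau>.\<close>

definition lagrange_const :: "real \<Rightarrow> (nat \<Rightarrow> real) \<Rightarrow> nat set \<Rightarrow> real" where
  "lagrange_const r c I = (\<Sum>i\<in>I. \<Prod>j\<in>I - {i}. 2 / (r * \<bar>c i - c j\<bar>))"

lemma lagrange_const_nonneg: "0 \<le> r \<Longrightarrow> 0 \<le> lagrange_const r c I"
  unfolding lagrange_const_def by (intro sum_nonneg prod_nonneg) auto

lemma sum_lagrange_basis_node_le:
  assumes r: "0 < r" "r < 1" and \<tau>: "0 < \<tau>" and c: "\<forall>i\<in>I. c i \<in> {0..1}" "inj_on c I"
    and \<theta>: "\<theta> \<in> {0..1}"
  shows "(\<Sum>i\<in>I. \<bar>poly (lagrange_basis (\<lambda>i. node r \<tau> k (c i)) I i) (node r \<tau> k \<theta>)\<bar>) \<le> lagrange_const r c I"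
  unfolding lagrange_const_def
proof (rule sum_mono)
  fix i assume i: "i \<in> I"
  let ?w = "step_width r \<tau> k"
  have w: "?w > 0" by (rule step_width_pos[OF \<tau>])
  show "\<bar>poly (lagrange_basis (\<lambda>i. node r \<tau> k (c i)) I i) (node r \<tau> k \<theta>)\<bar>
      \<le> (\<Prod>j\<in>I - {i}. 2 / (r * \<bar>c i - c j\<bar>))"
    unfolding poly_lagrange_basis abs_prod
  proof (intro prod_mono conjI)
    fix j assume j: "j \<in> I - {i}"
    have ne: "c i \<noteq> c j" using j i c by (auto dest: inj_onD)
    have 1: "\<bar>node r \<tau> k \<theta> - node r \<tau> k (c j)\<bar> \<le> ?w"
      using node_diff(2)[OF r \<tau>] \<theta> c j by auto
    have 2: "r / 2 * ?w * \<bar>c i - c j\<bar> \<le> \<bar>node r \<tau> k (c i) - node r \<tau> k (c j)\<bar>"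
      using node_diff(1)[OF r \<tau>] c i j by auto
    have "\<bar>node r \<tau> k \<theta> - node r \<tau> k (c j)\<bar> / \<bar>node r \<tau> k (c i) - node r \<tau> k (c j)\<bar>
        \<le> ?w / (r / 2 * ?w * \<bar>c i - c j\<bar>)"
      by (intro frac_le 1 2) (use w r ne in auto)
    also have "\<dots> = 2 / (r * \<bar>c i - c j\<bar>)" using w by simp
    finally show "\<bar>(node r \<tau> k \<theta> - node r \<tau> k (c j)) / (node r \<tau> k (c i) - node r \<tau> k (c j))\<bar>
      \<le> 2 / (r * \<bar>c i - c j\<bar>)" by simp
  qed simp
qed

lemma interp_error_lagrange:
  assumes r: "0 < r" "r < 1" and \<tau>: "0 < \<tau>" and c: "\<forall>i\<in>{1..\<nu>}. c i \<in> {0..1}" "inj_on c {1..\<nu>}"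
  shows "interp_error h r \<nu> c \<tau> k \<theta> = h (node r \<tau> k \<theta>)
    - (\<Sum>i\<in>{1..\<nu>}. poly (lagrange_basis (\<lambda>i. node r \<tau> k (c i)) {1..\<nu>} i) (node r \<tau> k \<theta>) *\<^sub>R h (node r \<tau> k (c i)))"
  \<comment> \<open>\<open>node\<close> is written as
    \<open>real k * \<tau> + \<theta> * \<tau>\<close>, not as a multiple of
    \<open>real k + \<theta>\<close>, so that unfolding it yields literally the nodes of
    \<open>interp_coef\<close>.\<close>
  using interp_coef_poly[OF inj_on_node[OF assms, of k, unfolded node_def], where h = h and z = "node r \<tau> k \<theta>"]
  by (simp add: interp_error_def node_def)

lemma lagrange_remainder_bound:
  fixes R :: "real \<Rightarrow> 'a::real_normed_vector"
  assumes \<Lambda>: "(\<Sum>i\<in>I. \<bar>l i\<bar>) \<le> \<Lambda>"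
    and z: "norm (R z) \<le> B" and x: "\<And>i. i \<in> I \<Longrightarrow> norm (R (x i)) \<le> B"
  shows "norm (R z - (\<Sum>i\<in>I. l i *\<^sub>R R (x i))) \<le> (1 + \<Lambda>) * B"
proof -
  have B: "0 \<le> B" using z norm_ge_zero order_trans by blast
  have "norm (\<Sum>i\<in>I. l i *\<^sub>R R (x i)) \<le> (\<Sum>i\<in>I. \<bar>l i\<bar> * B)"
    by (rule sum_norm_le) (use x in \<open>auto intro: mult_left_mono\<close>)
  also have "\<dots> \<le> \<Lambda> * B" using \<Lambda> B by (simp add: sum_distrib_right[symmetric] mult_right_mono)
  finally show ?thesis using norm_triangle_ineq4[of "R z" "\<Sum>i\<in>I. l i *\<^sub>R R (x i)"] z
    by (simp add: algebra_simps)
qed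

text \<open>The centre is the left end of the step, which need not be an interpolation node. It lies
  below every node and evaluation point of the step, so the expansion only ever runs to the
  right.\<close>

lemma taylor_remainder_node_bound:
  fixes D :: "nat \<Rightarrow> real \<Rightarrow> 'a::banach"
  assumes r: "0 < r" "r < 1" and \<tau>: "0 < \<tau>" and p: "p > 0"
    and D: "\<And>k x. k < p \<Longrightarrow> 0 \<le> x \<Longrightarrow> (D k has_vector_derivative D (Suc k) x) (at x within {0..})"
    and K: "\<And>x. 0 \<le> x \<Longrightarrow> norm (D p x) \<le> K"
    and \<theta>: "\<theta> \<in> {0..1}"
  shows "norm (D 0 (node r \<tau> k \<theta>) -
      (\<Sum>j<p. (node r \<tau> k \<theta> - node r \<tau> k 0) ^ j *\<^sub>R ((1 / fact j) *\<^sub>R D j (node r \<tau> k 0))))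
    \<le> K * step_width r \<tau> k ^ p"
proof -
  have m: "node r \<tau> k 0 \<le> node r \<tau> k \<theta>" using node_mono r \<tau> \<theta> by simp
  have w: "node r \<tau> k \<theta> - node r \<tau> k 0 \<le> step_width r \<tau> k"
    using node_diff(2)[OF r \<tau>, of 0 \<theta> k] \<theta> by simp
  have "0 \<le> K" using K[of 0] norm_ge_zero order_trans by blast
  then have "K * (node r \<tau> k \<theta> - node r \<tau> k 0) ^ p \<le> K * step_width r \<tau> k ^ p"
    using m w by (intro mult_left_mono power_mono) auto
  with taylor_remainder_bound[OF p D K node_nonneg m, simplified] show ?thesis by simp
qed

lemma interp_error_bound:
  fixes D :: "nat \<Rightarrow> real \<Rightarrow> 'a::banach"
  assumes r: "0 < r" "r < 1" and \<tau>: "0 < \<tau>" and nu: "\<nu> \<ge> 1"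
    and c: "\<forall>i\<in>{1..\<nu>}. c i \<in> {0..1}" "inj_on c {1..\<nu>}"
    and D: "\<And>k x. k < \<nu> \<Longrightarrow> 0 \<le> x \<Longrightarrow> (D k has_vector_derivative D (Suc k) x) (at x within {0..})"
    and K: "\<And>x. 0 \<le> x \<Longrightarrow> norm (D \<nu> x) \<le> K"
    and \<theta>: "\<theta> \<in> {0..1}"
  shows "norm (interp_error (D 0) r \<nu> c \<tau> k \<theta>) \<le> (1 + lagrange_const r c {1..\<nu>}) * (K * step_width r \<tau> k ^ \<nu>)"
proof -
  define x where "x i = node r \<tau> k (c i)" for i
  define z where "z = node r \<tau> k \<theta>"
  define l where "l i = poly (lagrange_basis x {1..\<nu>} i) z" for i
  define P where "P y = (\<Sum>j<\<nu>. (y - node r \<tau> k 0) ^ j *\<^sub>R ((1 / fact j) *\<^sub>R D j (node r \<tau> k 0)))" for y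
  have inj: "inj_on x {1..\<nu>}" unfolding x_def by (rule inj_on_node[OF r \<tau> c])
  have "interp_error (D 0) r \<nu> c \<tau> k \<theta> = D 0 z - (\<Sum>i\<in>{1..\<nu>}. l i *\<^sub>R D 0 (x i))"
    unfolding interp_error_lagrange[OF r \<tau> c] x_def z_def l_def ..
  \<comment> \<open>Interpolation with \<nu> nodes reproduces the Taylor polynomial
    \<open>P\<close>, so it drops out and only remainders are multiplied by the Lagrange
    weights.\<close>
  also have "\<dots> = (D 0 z - P z) - (\<Sum>i\<in>{1..\<nu>}. l i *\<^sub>R (D 0 (x i) - P (x i)))"
    using lagrange_sum_reproduce[OF _ inj, of \<nu> z "node r \<tau> k 0" "\<lambda>j. (1 / fact j) *\<^sub>R D j (node r \<tau> k 0)"]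
    by (simp add: P_def l_def scaleR_diff_right sum_subtractf)
  also have "norm \<dots> \<le> (1 + lagrange_const r c {1..\<nu>}) * (K * step_width r \<tau> k ^ \<nu>)"
  proof (rule lagrange_remainder_bound[where R = "\<lambda>y. D 0 y - P y"])
    show "(\<Sum>i\<in>{1..\<nu>}. \<bar>l i\<bar>) \<le> lagrange_const r c {1..\<nu>}"
      unfolding l_def x_def z_def by (rule sum_lagrange_basis_node_le[OF r \<tau> c \<theta>])
    have *: "norm (D 0 (node r \<tau> k \<sigma>) - P (node r \<tau> k \<sigma>)) \<le> K * step_width r \<tau> k ^ \<nu>" if "\<sigma> \<in> {0..1}" for \<sigma>
      unfolding P_def using nu by (intro taylor_remainder_node_bound r \<tau> D K that) auto
    show "norm (D 0 z - P z) \<le> K * step_width r \<tau> k ^ \<nu>" unfolding z_def by (rule *[OF \<theta>])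
    show "norm (D 0 (x i) - P (x i)) \<le> K * step_width r \<tau> k ^ \<nu>" if "i \<in> {1..\<nu>}" for i
      unfolding x_def using c that by (intro *) auto
  qed
  finally show ?thesis .
qed

text \<open>After division by the width, the factors \<open>u i\<close> and their linear models
  \<open>r * (\<theta> - c i)\<close> are all at most 1 in modulus. The difference of the products
  is then at most the sum of the differences of the factors, each of which is at most 1/max(1,
  k).\<close>

lemma prod_node_diff:
  assumes r: "0 < r" "r < 1" and \<tau>: "0 < \<tau>" and c: "\<forall>i\<in>I. c i \<in> {0..1}" and \<theta>: "\<theta> \<in> {0..1}"
  shows "\<bar>(\<Prod>i\<in>I. node r \<tau> k \<theta> - node r \<tau> k (c i)) - (r * step_width r \<tau> k) ^ card I * (\<Prod>i\<in>I. \<theta> - c i)\<bar>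
    \<le> step_width r \<tau> k ^ card I * (real (card I) / max 1 (real k))"
proof -
  let ?w = "step_width r \<tau> k"
  have w: "?w > 0" by (rule step_width_pos[OF \<tau>])
  define u where "u i = (node r \<tau> k \<theta> - node r \<tau> k (c i)) / ?w" for i
  have uw: "node r \<tau> k \<theta> - node r \<tau> k (c i) = ?w * u i" for i using w by (simp add: u_def)
  have u1: "\<bar>u i\<bar> \<le> 1" if "i \<in> I" for i
    using node_diff(2)[OF r \<tau>, of "c i" \<theta> k] c \<theta> that w by (simp add: u_def)
  have u2: "\<bar>u i - r * (\<theta> - c i)\<bar> \<le> 1 / max 1 (real k)" if i: "i \<in> I" for i
  proof -
    have "?w * \<bar>u i - r * (\<theta> - c i)\<bar> = \<bar>?w * u i - r * ?w * (\<theta> - c i)\<bar>"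
      using w abs_mult[of ?w "u i - r * (\<theta> - c i)"] by (simp add: algebra_simps)
    also have "\<dots> \<le> ?w * (1 / max 1 (real k))"
      using node_diff(3)[OF r \<tau>, of "c i" \<theta> k] c \<theta> i by (simp add: uw)
    finally show ?thesis using w by (simp only: mult_le_cancel_left_pos)
  qed
  have r1: "\<bar>r * (\<theta> - c i)\<bar> \<le> 1" if "i \<in> I" for i
  proof -
    have "0 \<le> c i" "c i \<le> 1" using c that by auto
    then have "\<bar>r\<bar> * \<bar>\<theta> - c i\<bar> \<le> 1 * 1" using r \<theta> by (intro mult_mono) auto
    then show ?thesis by (simp add: abs_mult)
  qed
  have "\<bar>(\<Prod>i\<in>I. u i) - (\<Prod>i\<in>I. r * (\<theta> - c i))\<bar> \<le> (\<Sum>i\<in>I. \<bar>u i - r * (\<theta> - c i)\<bar>)"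
    using norm_prod_diff[of I u "\<lambda>i. r * (\<theta> - c i)"] u1 r1 by simp
  also have "\<dots> \<le> (\<Sum>i\<in>I. 1 / max 1 (real k))" by (intro sum_mono u2)
  finally have "?w ^ card I * \<bar>(\<Prod>i\<in>I. u i) - (\<Prod>i\<in>I. r * (\<theta> - c i))\<bar> \<le> ?w ^ card I * (real (card I) / max 1 (real k))"
    using w by (intro mult_left_mono) auto
  moreover have "(\<Prod>i\<in>I. node r \<tau> k \<theta> - node r \<tau> k (c i)) - (r * ?w) ^ card I * (\<Prod>i\<in>I. \<theta> - c i)
      = ?w ^ card I * ((\<Prod>i\<in>I. u i) - (\<Prod>i\<in>I. r * (\<theta> - c i)))"
    unfolding uw prod.distrib by (simp add: power_mult_distrib right_diff_distrib[of "_ ^ _"])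
  ultimately show ?thesis using w by (simp add: abs_mult)
qed

text \<open>The expansion goes one order beyond what interpolation reproduces. The extra power
  leaves exactly the node polynomial times \<open>v\<close>; the first error term is the Taylor
  remainder, the second the linearisation of that polynomial.\<close>

lemma interp_error_expansion:
  fixes D :: "nat \<Rightarrow> real \<Rightarrow> 'a::banach" and k :: nat
  assumes r: "0 < r" "r < 1" and \<tau>: "0 < \<tau>" and nu: "\<nu> \<ge> 1"
    and c: "\<forall>i\<in>{1..\<nu>}. c i \<in> {0..1}" "inj_on c {1..\<nu>}"
    and D: "\<And>k x. k < Suc \<nu> \<Longrightarrow> 0 \<le> x \<Longrightarrow> (D k has_vector_derivative D (Suc k) x) (at x within {0..})"
    and K: "\<And>x. 0 \<le> x \<Longrightarrow> norm (D (Suc \<nu>) x) \<le> K"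
    and K': "\<And>x. 0 \<le> x \<Longrightarrow> norm (D \<nu> x) \<le> K'"
    and \<theta>: "\<theta> \<in> {0..1}"
  defines "v \<equiv> (1 / fact \<nu>) *\<^sub>R D \<nu> (node r \<tau> k 0)"
  shows "norm (interp_error (D 0) r \<nu> c \<tau> k \<theta> - ((r * step_width r \<tau> k) ^ \<nu> * (\<Prod>i\<in>{1..\<nu>}. \<theta> - c i)) *\<^sub>R v)
    \<le> (1 + lagrange_const r c {1..\<nu>}) * (K * step_width r \<tau> k ^ Suc \<nu>)
      + step_width r \<tau> k ^ \<nu> * (real \<nu> / max 1 (real k)) * K'"
proof -
  define a where "a = node r \<tau> k 0"
  define x where "x i = node r \<tau> k (c i)" for i
  define z where "z = node r \<tau> k \<theta>"
  define l where "l i = poly (lagrange_basis x {1..\<nu>} i) z" for i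
  define d where "d j = (1 / fact j) *\<^sub>R D j a" for j
  define P where "P y = (\<Sum>j<\<nu>. (y - a) ^ j *\<^sub>R d j)" for y
  define R where "R y = D 0 y - (P y + (y - a) ^ \<nu> *\<^sub>R v)" for y
  let ?w = "step_width r \<tau> k"
  define Q where "Q = (r * ?w) ^ \<nu> * (\<Prod>i\<in>{1..\<nu>}. \<theta> - c i)"
  have vd: "v = d \<nu>" by (simp add: v_def d_def a_def)
  have inj: "inj_on x {1..\<nu>}" unfolding x_def by (rule inj_on_node[OF r \<tau> c])
  have P: "(\<Sum>i\<in>{1..\<nu>}. l i *\<^sub>R P (x i)) = P z"
    unfolding P_def l_def by (rule lagrange_sum_reproduce[OF _ inj]) auto
  have pw: "(z - a) ^ \<nu> - (\<Sum>i\<in>{1..\<nu>}. l i * (x i - a) ^ \<nu>) = (\<Prod>i\<in>{1..\<nu>}. z - x i)"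
    using lagrange_power_error[OF _ inj, of z a] by (simp add: l_def mult.commute)
  have "interp_error (D 0) r \<nu> c \<tau> k \<theta> = D 0 z - (\<Sum>i\<in>{1..\<nu>}. l i *\<^sub>R D 0 (x i))"
    unfolding interp_error_lagrange[OF r \<tau> c] x_def z_def l_def ..
  also have "\<dots> = (R z - (\<Sum>i\<in>{1..\<nu>}. l i *\<^sub>R R (x i))) + (P z - (\<Sum>i\<in>{1..\<nu>}. l i *\<^sub>R P (x i)))
      + ((z - a) ^ \<nu> - (\<Sum>i\<in>{1..\<nu>}. l i * (x i - a) ^ \<nu>)) *\<^sub>R v"
    by (simp add: R_def scaleR_diff_right scaleR_add_right scaleR_diff_left scaleR_sum_left sum_subtractf sum.distrib)
  also have "\<dots> = (R z - (\<Sum>i\<in>{1..\<nu>}. l i *\<^sub>R R (x i))) + (\<Prod>i\<in>{1..\<nu>}. z - x i) *\<^sub>R v"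
    unfolding P pw by simp
  finally have "interp_error (D 0) r \<nu> c \<tau> k \<theta> - Q *\<^sub>R v =
      (R z - (\<Sum>i\<in>{1..\<nu>}. l i *\<^sub>R R (x i))) + ((\<Prod>i\<in>{1..\<nu>}. z - x i) - Q) *\<^sub>R v"
    by (simp add: scaleR_diff_left)
  moreover have "norm (R z - (\<Sum>i\<in>{1..\<nu>}. l i *\<^sub>R R (x i))) \<le> (1 + lagrange_const r c {1..\<nu>}) * (K * ?w ^ Suc \<nu>)"
  proof (rule lagrange_remainder_bound)
    show "(\<Sum>i\<in>{1..\<nu>}. \<bar>l i\<bar>) \<le> lagrange_const r c {1..\<nu>}"
      unfolding l_def x_def z_def by (rule sum_lagrange_basis_node_le[OF r \<tau> c \<theta>])
    have *: "norm (R (node r \<tau> k \<sigma>)) \<le> K * ?w ^ Suc \<nu>" if \<sigma>: "\<sigma> \<in> {0..1}" for \<sigma>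
      using taylor_remainder_node_bound[OF r \<tau> zero_less_Suc D K \<sigma>, of k]
      by (simp add: R_def P_def vd d_def a_def)
    show "norm (R z) \<le> K * ?w ^ Suc \<nu>" unfolding z_def by (rule *[OF \<theta>])
    show "norm (R (x i)) \<le> K * ?w ^ Suc \<nu>" if "i \<in> {1..\<nu>}" for i
      unfolding x_def using c that by (intro *) auto
  qed
  moreover have "norm (((\<Prod>i\<in>{1..\<nu>}. z - x i) - Q) *\<^sub>R v) \<le> ?w ^ \<nu> * (real \<nu> / max 1 (real k)) * K'"
    unfolding norm_scaleR
  proof (rule mult_mono)
    show "\<bar>(\<Prod>i\<in>{1..\<nu>}. z - x i) - Q\<bar> \<le> ?w ^ \<nu> * (real \<nu> / max 1 (real k))"
      using prod_node_diff[OF r \<tau> c(1) \<theta>, of k] by (simp add: z_def x_def Q_def)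
    have "norm v \<le> norm (D \<nu> a)"
      unfolding v_def a_def by (simp add: divide_le_eq mult_left_le[of 1] order.trans[OF _ mult_left_mono[of 1 "fact \<nu>"]])
    also have "\<dots> \<le> K'" unfolding a_def by (intro K' node_nonneg)
    finally show "norm v \<le> K'" .
    show "0 \<le> ?w ^ \<nu> * (real \<nu> / max 1 (real k))" using step_width_pos[OF \<tau>, of r k] by simp
  qed simp
  ultimately show ?thesis
    unfolding Q_def[symmetric] by (simp only:) (rule norm_triangle_le, rule add_mono)
qed

section \<open>Global error\<close>

lemma eqrf_error_le_sum:
  fixes S :: "real \<Rightarrow> 'a::banach \<Rightarrow>\<^sub>L 'a"
  assumes sg: "c0_semigroup S" and M: "0 \<le> M" "\<And>t x. 0 \<le> t \<Longrightarrow> t \<le> T \<Longrightarrow> norm (S t x) \<le> M * norm x"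
    and h: "continuous_on {0..} h" and r: "0 < r" and T: "0 < T" and nu: "\<nu> \<ge> 1"
    and \<tau>: "\<tau> = T / real N" and n: "N > 0" "n \<le> N"
    and b: "\<And>k. k < N \<Longrightarrow> norm (integral {0..1} (\<lambda>\<theta>. S ((1 - \<theta>) * \<tau>) (interp_error h r \<nu> c \<tau> k \<theta>))) \<le> b k"
  shows "norm (mild_sol S h r y0 (real n * \<tau>) - eqrf S h r \<nu> c \<tau> y0 n) \<le> M * (\<tau> * (\<Sum>k<N. b k))"
proof -
  have \<tau>0: "0 < \<tau>" using T n by (simp add: \<tau>)
  have b0: "0 \<le> b k" if "k < N" for k using b[OF that] norm_ge_zero order_trans by blast
  define d where "d k = \<tau> *\<^sub>R integral {0..1} (\<lambda>\<theta>. S ((1 - \<theta>) * \<tau>) (interp_error h r \<nu> c \<tau> k \<theta>))" for k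
  have "norm (mild_sol S h r y0 (real n * \<tau>) - eqrf S h r \<nu> c \<tau> y0 n) \<le> M * (\<Sum>k<n. norm (d k))"
  proof (rule c0_semigroup_error_accumulation[OF sg M(2)])
    show "real N * \<tau> \<le> T" using n by (simp add: \<tau>)
    show "mild_sol S h r y0 (real 0 * \<tau>) - eqrf S h r \<nu> c \<tau> y0 0 = 0"
      by (simp add: mild_sol_def c0_semigroup_0[OF sg])
    show "mild_sol S h r y0 (real (Suc k) * \<tau>) - eqrf S h r \<nu> c \<tau> y0 (Suc k)
        = S \<tau> (mild_sol S h r y0 (real k * \<tau>) - eqrf S h r \<nu> c \<tau> y0 k) + d k" for k
      unfolding d_def by (rule eqrf_error_step[OF sg h r \<tau>0 nu])
  qed (use n \<tau>0 in auto)
  also have "(\<Sum>k<n. norm (d k)) \<le> (\<Sum>k<n. \<tau> * b k)"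
    using b n \<tau>0 by (intro sum_mono) (auto simp: d_def intro!: mult_left_mono)
  \<comment> \<open>Extending the sum to the whole grid makes the bound independent of
    \<open>n\<close>; the added terms are nonnegative because each \<open>b k\<close> dominates a
    norm.\<close>
  also have "\<dots> \<le> (\<Sum>k<N. \<tau> * b k)"
    using n b0 \<tau>0 by (intro sum_mono2) auto
  finally show ?thesis using M(1) by (simp add: sum_distrib_left mult_left_mono)
qed

text \<open>The sum over the steps stays explicit, so that the three regimes become a question about
  powers of \<open>k\<close> alone. \<open>C \<ge> 0\<close> is recorded because a bound for that
  sum is multiplied by \<open>C\<close> later.\<close>

lemma eqrf_error_bound:
  fixes S :: "real \<Rightarrow> 'a::banach \<Rightarrow>\<^sub>L 'a" and D :: "nat \<Rightarrow> real \<Rightarrow> 'a"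
  assumes sg: "c0_semigroup S" and T: "0 < T" and r: "0 < r" "r < 1" and nu: "\<nu> \<ge> 1"
    and c: "\<forall>i\<in>{1..\<nu>}. c i \<in> {0..1}" "inj_on c {1..\<nu>}"
    and D: "\<And>k x. k < \<nu> \<Longrightarrow> 0 \<le> x \<Longrightarrow> (D k has_vector_derivative D (Suc k) x) (at x within {0..})"
    and bdd: "bounded (D \<nu> ` {0..})"
  shows "\<exists>C\<ge>0. \<forall>N>0. \<forall>n\<le>N.
    norm (mild_sol S (D 0) r y0 (real n * (T / real N)) - eqrf S (D 0) r \<nu> c (T / real N) y0 n)
    \<le> C * ((T / real N) powr (1 + real \<nu> * r) * (\<Sum>k<N. max 1 (real k) powr ((r - 1) * real \<nu>)))"
proof -
  obtain M where M: "M \<ge> 1" "\<And>t x. 0 \<le> t \<Longrightarrow> t \<le> T \<Longrightarrow> norm (S t x) \<le> M * norm x"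
    using c0_semigroup_bounded_on[OF sg] by blast
  obtain K where K: "\<And>x. 0 \<le> x \<Longrightarrow> norm (D \<nu> x) \<le> K"
    using bdd by (auto simp: bounded_iff)
  have K0: "0 \<le> K" using K[of 0] norm_ge_zero order_trans by blast
  have h: "continuous_on {0..} (D 0)"
    using D[of 0] nu by (intro continuous_on_vector_derivative) auto
  define \<Lambda> where "\<Lambda> = lagrange_const r c {1..\<nu>}"
  have \<Lambda>: "0 \<le> \<Lambda>" unfolding \<Lambda>_def using r by (intro lagrange_const_nonneg) simp
  define B where "B = M * ((1 + \<Lambda>) * K)"
  have B: "0 \<le> B" using M \<Lambda> K0 by (simp add: B_def)
  have "norm (mild_sol S (D 0) r y0 (real n * \<tau>) - eqrf S (D 0) r \<nu> c \<tau> y0 n)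
      \<le> M * B * (\<tau> powr (1 + real \<nu> * r) * (\<Sum>k<N. max 1 (real k) powr ((r - 1) * real \<nu>)))"
    if N: "N > 0" "n \<le> N" and \<tau>_def: "\<tau> = T / real N" for N n \<tau>
  proof -
    have \<tau>: "0 < \<tau>" "\<tau> \<le> T" using T N by (auto simp: \<tau>_def divide_le_eq)
    have "norm (integral {0..1} (\<lambda>\<theta>. S ((1 - \<theta>) * \<tau>) (interp_error (D 0) r \<nu> c \<tau> k \<theta>)))
        \<le> B * step_width r \<tau> k ^ \<nu>" for k
    proof -
      have "norm (integral {0..1} (\<lambda>\<theta>. S ((1 - \<theta>) * \<tau>) (interp_error (D 0) r \<nu> c \<tau> k \<theta>)))
          \<le> B * step_width r \<tau> k ^ \<nu> * (1 - 0)"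
      proof (rule integral_bound)
        show "continuous_on {0..1} (\<lambda>\<theta>. S ((1 - \<theta>) * \<tau>) (interp_error (D 0) r \<nu> c \<tau> k \<theta>))"
          using r \<tau> by (intro c0_semigroup_continuous_on_compose[OF sg] continuous_on_interp_error[OF h] continuous_intros) auto
        fix \<theta> :: real assume \<theta>: "\<theta> \<in> {0..1}"
        have "(1 - \<theta>) * \<tau> \<le> 1 * T" using \<theta> \<tau> by (intro mult_mono) auto
        then have "norm (S ((1 - \<theta>) * \<tau>) (interp_error (D 0) r \<nu> c \<tau> k \<theta>)) \<le> M * norm (interp_error (D 0) r \<nu> c \<tau> k \<theta>)"
          using \<theta> \<tau> by (intro M(2)) auto
        also have "\<dots> \<le> M * ((1 + \<Lambda>) * (K * step_width r \<tau> k ^ \<nu>))"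
          unfolding \<Lambda>_def using M(1) by (intro mult_left_mono interp_error_bound r \<tau> nu c D K \<theta>) auto
        also have "\<dots> = B * step_width r \<tau> k ^ \<nu>" by (simp add: B_def mult_ac)
        finally show "norm (S ((1 - \<theta>) * \<tau>) (interp_error (D 0) r \<nu> c \<tau> k \<theta>)) \<le> B * step_width r \<tau> k ^ \<nu>" .
      qed simp
      then show ?thesis by simp
    qed
    then have "norm (mild_sol S (D 0) r y0 (real n * \<tau>) - eqrf S (D 0) r \<nu> c \<tau> y0 n)
        \<le> M * (\<tau> * (\<Sum>k<N. B * step_width r \<tau> k ^ \<nu>))"
      using M T N nu r by (intro eqrf_error_le_sum[OF sg _ _ h _ T _ \<tau>_def]) auto
    also have "\<dots> = M * B * ((\<tau> * \<tau> powr (real \<nu> * r)) * (\<Sum>k<N. max 1 (real k) powr ((r - 1) * real \<nu>)))"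
      using \<tau> by (simp add: step_width_power sum_distrib_left mult_ac)
    also have "\<tau> * \<tau> powr (real \<nu> * r) = \<tau> powr (1 + real \<nu> * r)"
      using \<tau> by (simp add: powr_add)
    finally show ?thesis .
  qed
  then show ?thesis using M B by (intro exI[of _ "M * B"]) auto
qed

text \<open>With a = (r - 1)\<nu> one has (1 + \<nu>r) - \<nu> = a + 1. Hence the sign of a + 1
  decides at once whether the sum of k^a stays bounded and which of the two exponents is the
  minimum; equality is the logarithmic case.\<close>

lemma sum_step_scale_order:
  fixes T r :: real
  assumes T: "0 < T" and r: "0 < r" "r < 1" and nu: "\<nu> \<ge> 1"
  shows "\<exists>C. \<forall>N>0. (T / real N) powr (1 + real \<nu> * r) * (\<Sum>k<N. max 1 (real k) powr ((r - 1) * real \<nu>))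
    \<le> C * (if r \<noteq> (real \<nu> - 1) / real \<nu> then (T / real N) powr (min (1 + real \<nu> * r) (real \<nu>))
        else (T / real N) ^ \<nu> * (1 + \<bar>ln (T / real N)\<bar>))"
    (is "\<exists>C. \<forall>N>0. ?\<tau> N powr ?q * ?\<Sigma> N \<le> C * ?rhs N")
proof -
  let ?a = "(r - 1) * real \<nu>"
  consider "?a < -1" | "?a = -1" | "?a > -1" by linarith
  then show ?thesis
  proof cases
    case 1
    then have q: "?q < real \<nu>" by (simp add: algebra_simps)
    then have ne: "r \<noteq> (real \<nu> - 1) / real \<nu>" using nu by (auto simp: field_simps)
    obtain C where C: "\<And>N. ?\<Sigma> N \<le> C" using sum_powr_bounded[OF 1] by blast
    have "?\<tau> N powr ?q * ?\<Sigma> N \<le> C * ?rhs N" for N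
    proof -
      have "?rhs N = ?\<tau> N powr ?q" using ne q by simp
      then show ?thesis using mult_left_mono[OF C[of N], of "?\<tau> N powr ?q"] by (simp add: mult.commute)
    qed
    then show ?thesis by blast
  next
    case 2
    then have q: "?q = real \<nu>" by (simp add: algebra_simps)
    then have eq: "r = (real \<nu> - 1) / real \<nu>" using nu by (simp add: field_simps)
    define L where "L = \<bar>ln T\<bar>"
    have "?\<tau> N powr ?q * ?\<Sigma> N \<le> (2 + L) * ?rhs N" if N: "N > 0" for N
    proof -
      \<comment> \<open>The harmonic sum produces ln N, which is ln T - ln \<tau>; the part
        depending on \<open>T\<close> goes into the constant \<open>2 + L\<close>.\<close>
      have "ln (real N) = ln T - ln (?\<tau> N)" using N T by (simp add: ln_div)
      then have "2 + ln (real N) \<le> 2 + L + \<bar>ln (?\<tau> N)\<bar>" unfolding L_def by linarith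
      also have "\<dots> \<le> (2 + L) * (1 + \<bar>ln (?\<tau> N)\<bar>)" by (simp add: algebra_simps L_def)
      finally have "?\<Sigma> N \<le> (2 + L) * (1 + \<bar>ln (?\<tau> N)\<bar>)"
        using sum_inverse_le[OF N] unfolding 2 by linarith
      then have "?\<tau> N ^ \<nu> * ?\<Sigma> N \<le> ?\<tau> N ^ \<nu> * ((2 + L) * (1 + \<bar>ln (?\<tau> N)\<bar>))"
        using T by (intro mult_left_mono) auto
      moreover have "?\<tau> N powr ?q = ?\<tau> N ^ \<nu>" unfolding q using N T by (intro powr_realpow) auto
      moreover have "?rhs N = ?\<tau> N ^ \<nu> * (1 + \<bar>ln (?\<tau> N)\<bar>)" using eq by simp
      ultimately show ?thesis by (simp only: mult_ac)
    qed
    then show ?thesis by blast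
  next
    case 3
    then have q: "real \<nu> < ?q" by (simp add: algebra_simps)
    then have ne: "r \<noteq> (real \<nu> - 1) / real \<nu>" using nu by (auto simp: field_simps)
    have a0: "?a \<le> 0" using r by (simp add: mult_nonpos_nonneg)
    define C where "C = 1 + 1 / (?a + 1)"
    have "?\<tau> N powr ?q * ?\<Sigma> N \<le> (C * T powr (?a + 1)) * ?rhs N" if N: "N > 0" for N
    proof -
      have \<tau>: "?\<tau> N > 0" using N T by simp
      have "?\<tau> N powr ?q * ?\<Sigma> N \<le> ?\<tau> N powr ?q * (C * real N powr (?a + 1))"
        unfolding C_def by (intro mult_left_mono sum_powr_le 3 a0 N) auto
      \<comment> \<open>Writing N as T/\<tau> turns the growth of the sum into a loss of a + 1
        powers of \<tau>, which lowers the order from 1 + \<nu>r to \<nu>.\<close>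
      also have "real N powr (?a + 1) = T powr (?a + 1) / ?\<tau> N powr (?a + 1)"
        using N T by (simp add: powr_divide)
      also have "?\<tau> N powr ?q * (C * (T powr (?a + 1) / ?\<tau> N powr (?a + 1)))
          = C * T powr (?a + 1) * ?\<tau> N powr (?q - (?a + 1))"
        by (simp only: powr_diff) simp
      also have "?q - (?a + 1) = real \<nu>" by (simp add: algebra_simps)
      also have "?\<tau> N powr real \<nu> = ?rhs N" using ne q by simp
      finally show ?thesis .
    qed
    then show ?thesis by blast
  qed
qed

section \<open>Cancellation of the leading term under the quadrature condition\<close>

lemma eqrf_superconvergence_step:
  fixes S :: "real \<Rightarrow> 'a::banach \<Rightarrow>\<^sub>L 'a" and D :: "nat \<Rightarrow> real \<Rightarrow> 'a"
  assumes sg: "c0_semigroup S" and gen: "is_generator S DA A"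
    and M: "M \<ge> 1" "\<And>t x. 0 \<le> t \<Longrightarrow> t \<le> T \<Longrightarrow> norm (S t x) \<le> M * norm x"
    and \<tau>: "0 < \<tau>" "\<tau> \<le> T" and r: "0 < r" "r < 1" and nu: "\<nu> \<ge> 1"
    and c: "\<forall>i\<in>{1..\<nu>}. c i \<in> {0..1}" "inj_on c {1..\<nu>}"
    and D: "\<And>k x. k < Suc \<nu> \<Longrightarrow> 0 \<le> x \<Longrightarrow> (D k has_vector_derivative D (Suc k) x) (at x within {0..})"
    and K: "\<And>x. 0 \<le> x \<Longrightarrow> norm (D (Suc \<nu>) x) \<le> K"
    and K': "\<And>x. 0 \<le> x \<Longrightarrow> norm (D \<nu> x) \<le> K'"
    and DA: "\<And>x. 0 \<le> x \<Longrightarrow> D \<nu> x \<in> DA" and KA: "\<And>x. 0 \<le> x \<Longrightarrow> norm (A (D \<nu> x)) \<le> KA"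
    and c_int: "integral {0..1} (\<lambda>s. \<Prod>i\<in>{1..\<nu>}. (s - c i)) = 0"
  shows "norm (integral {0..1} (\<lambda>\<theta>. S ((1 - \<theta>) * \<tau>) (interp_error (D 0) r \<nu> c \<tau> k \<theta>)))
    \<le> M * ((1 + lagrange_const r c {1..\<nu>}) * (K * step_width r \<tau> k ^ Suc \<nu>)
      + step_width r \<tau> k ^ \<nu> * (real \<nu> / max 1 (real k)) * K') + step_width r \<tau> k ^ \<nu> * (M * \<tau> * KA)"
    (is "norm ?I \<le> M * ?E + ?F")
proof -
  let ?w = "step_width r \<tau> k" and ?u = "D \<nu> (node r \<tau> k 0)"
  define q where "q \<theta> = (r * ?w) ^ \<nu> * (\<Prod>i\<in>{1..\<nu>}. \<theta> - c i)" for \<theta>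
  define v where "v = (1 / fact \<nu>) *\<^sub>R ?u"
  define g where "g \<theta> = S ((1 - \<theta>) * \<tau>) (interp_error (D 0) r \<nu> c \<tau> k \<theta>)" for \<theta>
  have w: "?w > 0" by (rule step_width_pos[OF \<tau>(1)])
  have h: "continuous_on {0..} (D 0)"
    using D[of 0] nu by (intro continuous_on_vector_derivative) auto
  have cg: "continuous_on {0..1} g" unfolding g_def
    using r \<tau> by (intro c0_semigroup_continuous_on_compose[OF sg] continuous_on_interp_error[OF h] continuous_intros) auto
  have cq: "continuous_on {0..1} q" unfolding q_def by (intro continuous_intros)
  \<comment> \<open>\<open>v\<close> is frozen at the left end of the step and the semigroup is left
    out, so \<theta> enters only through the scalar polynomial \<open>q\<close>. The quadrature
    condition makes its integral 0, and subtracting the term from the integrand changes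
    nothing.\<close>
  have "integral {0..1} (\<lambda>\<theta>. q \<theta> *\<^sub>R v) = integral {0..1} q *\<^sub>R v"
    using integrable_continuous_interval[OF cq] has_integral_scaleR_left[OF integrable_integral] integral_unique by blast
  also have "integral {0..1} q = 0" unfolding q_def using c_int by simp
  finally have "integral {0..1} g = integral {0..1} (\<lambda>\<theta>. g \<theta> - q \<theta> *\<^sub>R v)"
    by (subst integral_diff) (auto intro!: integrable_continuous_interval continuous_intros cg cq)
  also have "norm \<dots> \<le> (M * ?E + ?F) * (1 - 0)"
  proof (rule integral_bound)
    show "continuous_on {0..1} (\<lambda>\<theta>. g \<theta> - q \<theta> *\<^sub>R v)" by (intro continuous_intros cg cq)
    fix \<theta> :: real assume \<theta>: "\<theta> \<in> {0..1}"
    let ?t = "(1 - \<theta>) * \<tau>"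
    have t: "0 \<le> ?t" "?t \<le> \<tau>" using \<theta> \<tau> mult_right_mono[of "1 - \<theta>" 1 \<tau>] by auto
    have tT: "?t \<le> T" by (rule order_trans[OF t(2) \<tau>(2)])
    \<comment> \<open>The factor \<open>1 / fact \<nu>\<close> is moved out of \<open>v\<close> into
      the scalar, so the generator estimate is applied to \<open>?u\<close> itself, which is known
      to lie in \<open>DA\<close>.\<close>
    have "g \<theta> - q \<theta> *\<^sub>R v = S ?t (interp_error (D 0) r \<nu> c \<tau> k \<theta> - q \<theta> *\<^sub>R v) + (q \<theta> / fact \<nu>) *\<^sub>R (S ?t ?u - ?u)"
      by (simp add: g_def v_def blinfun.diff_right blinfun.scaleR_right scaleR_diff_right)
    moreover have "norm (S ?t (interp_error (D 0) r \<nu> c \<tau> k \<theta> - q \<theta> *\<^sub>R v)) \<le> M * ?E"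
    proof -
      have "norm (S ?t (interp_error (D 0) r \<nu> c \<tau> k \<theta> - q \<theta> *\<^sub>R v)) \<le> M * norm (interp_error (D 0) r \<nu> c \<tau> k \<theta> - q \<theta> *\<^sub>R v)"
        by (rule M(2)[OF t(1) tT])
      also have "\<dots> \<le> M * ?E"
        unfolding q_def v_def using M(1)
        by (intro mult_left_mono interp_error_expansion[OF r \<tau>(1) nu c D K K' \<theta>]) auto
      finally show ?thesis .
    qed
    moreover have "norm ((q \<theta> / fact \<nu>) *\<^sub>R (S ?t ?u - ?u)) \<le> ?F"
      unfolding norm_scaleR
    proof (rule mult_mono)
      have "\<bar>\<Prod>i\<in>{1..\<nu>}. \<theta> - c i\<bar> \<le> 1"
        unfolding abs_prod using c(1) \<theta> by (intro prod_le_1) force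
      moreover have "(r * ?w) ^ \<nu> \<le> ?w ^ \<nu>" using r w by (intro power_mono) auto
      ultimately have "(r * ?w) ^ \<nu> * \<bar>\<Prod>i\<in>{1..\<nu>}. \<theta> - c i\<bar> \<le> ?w ^ \<nu> * 1"
        using w by (intro mult_mono) auto
      then have q1: "\<bar>q \<theta>\<bar> \<le> ?w ^ \<nu>" using r w by (simp add: q_def abs_mult)
      have "\<bar>q \<theta> / fact \<nu>\<bar> \<le> \<bar>q \<theta>\<bar> / 1" unfolding abs_divide by (intro frac_le) auto
      then show "\<bar>q \<theta> / fact \<nu>\<bar> \<le> ?w ^ \<nu>" using q1 by simp
      have "norm (S ?t ?u - ?u) \<le> M * ?t * norm (A ?u)"
        by (rule generator_norm_diff_le[OF sg gen DA[OF node_nonneg] M(2) t(1) tT])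
      also have "\<dots> \<le> M * \<tau> * KA"
        using M(1) t \<tau> by (intro mult_mono KA node_nonneg) auto
      finally show "norm (S ?t ?u - ?u) \<le> M * \<tau> * KA" .
    qed (use w in auto)
    ultimately show "norm (g \<theta> - q \<theta> *\<^sub>R v) \<le> M * ?E + ?F"
      by (simp only:) (rule norm_triangle_le, rule add_mono)
  qed simp
  finally show ?thesis by (simp add: g_def[abs_def])
qed

lemma eqrf_superconvergence:
  fixes S :: "real \<Rightarrow> 'a::banach \<Rightarrow>\<^sub>L 'a" and D :: "nat \<Rightarrow> real \<Rightarrow> 'a"
  assumes sg: "c0_semigroup S" and gen: "is_generator S DA A"
    and T: "0 < T" and r: "0 < r" "r < 1" and nu: "\<nu> \<ge> 1"
    and c: "\<forall>i\<in>{1..\<nu>}. c i \<in> {0..1}" "inj_on c {1..\<nu>}"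
    and D: "\<And>k x. k < Suc \<nu> \<Longrightarrow> 0 \<le> x \<Longrightarrow> (D k has_vector_derivative D (Suc k) x) (at x within {0..})"
    and bdd: "bounded (D \<nu> ` {0..})" "bounded (D (Suc \<nu>) ` {0..})"
    and DA: "\<And>x. 0 \<le> x \<Longrightarrow> D \<nu> x \<in> DA" and bddA: "bounded ((\<lambda>x. A (D \<nu> x)) ` {0..})"
    and c_int: "integral {0..1} (\<lambda>s. \<Prod>i\<in>{1..\<nu>}. (s - c i)) = 0"
  shows "\<exists>C. \<forall>N>0. \<forall>n\<le>N.
    norm (mild_sol S (D 0) r y0 (real n * (T / real N)) - eqrf S (D 0) r \<nu> c (T / real N) y0 n)
    \<le> C * (T / real N) powr (1 + real \<nu> * r)"
proof -
  obtain M where M: "M \<ge> 1" "\<And>t x. 0 \<le> t \<Longrightarrow> t \<le> T \<Longrightarrow> norm (S t x) \<le> M * norm x"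
    using c0_semigroup_bounded_on[OF sg] by blast
  obtain K where K: "\<And>x. 0 \<le> x \<Longrightarrow> norm (D (Suc \<nu>) x) \<le> K"
    using bdd(2) by (auto simp: bounded_iff)
  obtain K' where K': "\<And>x. 0 \<le> x \<Longrightarrow> norm (D \<nu> x) \<le> K'"
    using bdd(1) by (auto simp: bounded_iff)
  obtain KA where KA: "\<And>x. 0 \<le> x \<Longrightarrow> norm (A (D \<nu> x)) \<le> KA"
    using bddA by (auto simp: bounded_iff)
  have K0: "0 \<le> K" "0 \<le> K'" "0 \<le> KA"
    using K[of 0] K'[of 0] KA[of 0] norm_ge_zero order_trans by blast+
  have h: "continuous_on {0..} (D 0)"
    using D[of 0] nu by (intro continuous_on_vector_derivative) auto
  define \<Lambda> where "\<Lambda> = lagrange_const r c {1..\<nu>}"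
  have \<Lambda>: "0 \<le> \<Lambda>" unfolding \<Lambda>_def using r by (intro lagrange_const_nonneg) simp
  obtain C2 where C2: "\<And>N. (\<Sum>k<N. max 1 (real k) powr (r - 2)) \<le> C2"
    using sum_powr_bounded[of "r - 2"] r by auto
  define B1 B2 B3 where "B1 = M * ((1 + \<Lambda>) * K)" and "B2 = M * real \<nu> * K'" and "B3 = M * KA"
  have B: "0 \<le> B1" "0 \<le> B2" "0 \<le> B3" using M \<Lambda> K0 by (auto simp: B1_def B2_def B3_def)
  define C where "C = B1 * ((1 + 1 / r) * T powr r) + B2 * C2 + B3 * T"
  have "norm (mild_sol S (D 0) r y0 (real n * \<tau>) - eqrf S (D 0) r \<nu> c \<tau> y0 n)
      \<le> M * C * \<tau> powr (1 + real \<nu> * r)"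
    if N: "N > 0" "n \<le> N" and \<tau>_def: "\<tau> = T / real N" for N n \<tau>
  proof -
    have \<tau>: "0 < \<tau>" "\<tau> \<le> T" using T N by (auto simp: \<tau>_def divide_le_eq)
    let ?w = "step_width r \<tau>" and ?m = "\<lambda>k. max 1 (real k)"
    let ?b = "\<lambda>k. \<tau> powr (real \<nu> * r) * (B1 * ?w k + B2 * ?m k powr (r - 2) + B3 * \<tau>)"
    have "norm (integral {0..1} (\<lambda>\<theta>. S ((1 - \<theta>) * \<tau>) (interp_error (D 0) r \<nu> c \<tau> k \<theta>))) \<le> ?b k" for k
    proof -
      have w: "0 < ?w k" by (rule step_width_pos[OF \<tau>(1)])
      have p: "?w k ^ \<nu> = \<tau> powr (real \<nu> * r) * step_scale r k ^ \<nu>"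
        using \<tau> by (simp add: step_width_def power_mult_distrib powr_power)
      have s: "0 < step_scale r k" "step_scale r k \<le> 1" using step_scale_pos step_scale_le_1 r by auto
      \<comment> \<open>Trading the \<nu>-th power for the first is affordable: after division by
        \<open>max 1 k\<close> the exponent is r - 2 < -1, so the sum over \<open>k\<close> is still
        bounded, for every \<nu>.\<close>
      then have s1: "step_scale r k ^ \<nu> \<le> step_scale r k"
        using nu power_decreasing[of 1 \<nu> "step_scale r k"] by simp
      have w1: "?w k ^ \<nu> \<le> \<tau> powr (real \<nu> * r)"
        unfolding p using s1 s by (intro mult_left_le) auto
      have w2: "?w k ^ \<nu> / ?m k \<le> \<tau> powr (real \<nu> * r) * ?m k powr (r - 2)"
      proof -
        have "?m k powr (r - 2) = step_scale r k / ?m k"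
          using powr_diff[of "?m k" "r - 1" 1] by (simp add: step_scale_def)
        then show ?thesis unfolding p using s1 by (simp add: divide_right_mono mult_left_mono)
      qed
      have "norm (integral {0..1} (\<lambda>\<theta>. S ((1 - \<theta>) * \<tau>) (interp_error (D 0) r \<nu> c \<tau> k \<theta>)))
          \<le> M * ((1 + \<Lambda>) * (K * ?w k ^ Suc \<nu>) + ?w k ^ \<nu> * (real \<nu> / ?m k) * K') + ?w k ^ \<nu> * (M * \<tau> * KA)"
        unfolding \<Lambda>_def
        by (rule eqrf_superconvergence_step[OF sg gen M \<tau> r nu c D K K' DA KA c_int])
      also have "\<dots> = B1 * (?w k ^ \<nu> * ?w k) + B2 * (?w k ^ \<nu> / ?m k) + B3 * (?w k ^ \<nu> * \<tau>)"
        by (simp add: B1_def B2_def B3_def algebra_simps)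
      also have "\<dots> \<le> B1 * (\<tau> powr (real \<nu> * r) * ?w k) + B2 * (\<tau> powr (real \<nu> * r) * ?m k powr (r - 2))
          + B3 * (\<tau> powr (real \<nu> * r) * \<tau>)"
        using w \<tau> by (intro add_mono mult_left_mono mult_right_mono w1 w2 B) auto
      also have "\<dots> = ?b k" by (simp add: algebra_simps)
      finally show ?thesis .
    qed
    then have "norm (mild_sol S (D 0) r y0 (real n * \<tau>) - eqrf S (D 0) r \<nu> c \<tau> y0 n) \<le> M * (\<tau> * (\<Sum>k<N. ?b k))"
      using M T N nu r by (intro eqrf_error_le_sum[OF sg _ _ h _ T _ \<tau>_def]) auto
    also have "(\<Sum>k<N. ?b k) = \<tau> powr (real \<nu> * r) *
        (B1 * (\<Sum>k<N. ?w k) + B2 * (\<Sum>k<N. ?m k powr (r - 2)) + B3 * (real N * \<tau>))"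
      by (simp add: sum_distrib_left[symmetric] sum.distrib)
    also have "\<dots> \<le> \<tau> powr (real \<nu> * r) * C"
    proof -
      \<comment> \<open>Up to the treatment of \<open>k = 0\<close> this is a Riemann sum of the
        integrable function s^(r-1) on [0, T]: it is bounded by a multiple of (\<tau>N)^r =
        T^r.\<close>
      have "(\<Sum>k<N. ?w k) = \<tau> powr r * (\<Sum>k<N. ?m k powr (r - 1))"
        by (simp add: step_width_def step_scale_def sum_distrib_left)
      also have "\<dots> \<le> \<tau> powr r * ((1 + 1 / r) * real N powr r)"
        using sum_powr_le[of "r - 1" N] r N by (intro mult_left_mono) auto
      also have "\<dots> = (1 + 1 / r) * (\<tau> * real N) powr r" by (simp add: powr_mult)
      also have "\<tau> * real N = T" using N by (simp add: \<tau>_def)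
      finally have "(\<Sum>k<N. ?w k) \<le> (1 + 1 / r) * T powr r" .
      moreover have "real N * \<tau> = T" using N by (simp add: \<tau>_def)
      ultimately show ?thesis
        unfolding C_def by (intro mult_left_mono add_mono C2 B) auto
    qed
    finally have "norm (mild_sol S (D 0) r y0 (real n * \<tau>) - eqrf S (D 0) r \<nu> c \<tau> y0 n)
        \<le> M * (\<tau> * (\<tau> powr (real \<nu> * r) * C))"
      using M(1) \<tau> by (simp add: mult_left_mono)
    also have "\<dots> = M * C * \<tau> powr (1 + real \<nu> * r)" using \<tau> by (simp add: powr_add)
    finally show ?thesis .
  qed
  then show ?thesis by blast
qed

text \<open>The derivatives of \<open>h\<close> are supplied as a family \<open>D\<close> with
  \<open>D 0 = h\<close>, which avoids choosing them; differentiating within \<open>{0..}\<close>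
  makes them one-sided at 0. The quantifier on \<open>C\<close> precedes those on \<open>N\<close>
  and \<open>n\<close>, which expresses the uniformity in the step size and the time level.\<close>

theorem theorem4:
  fixes S :: "real \<Rightarrow> 'a::banach \<Rightarrow>\<^sub>L 'a"
    and DA :: "'a set" and A :: "'a \<Rightarrow> 'a"
    and T r :: real and y0 :: 'a and h :: "real \<Rightarrow> 'a"
    and \<nu> :: nat and c :: "nat \<Rightarrow> real"
    and D :: "nat \<Rightarrow> real \<Rightarrow> 'a"
  assumes sg: "c0_semigroup S"
    and gen: "is_generator S DA A"
    and T: "T > 0"
    and r: "0 < r" "r < 1"
    and nu: "\<nu> \<ge> 1"
    and c_range: "\<forall>i\<in>{1..\<nu>}. c i \<in> {0..1}"
    and c_dist: "inj_on c {1..\<nu>}"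
    and D0: "D 0 = h"
  shows
    "((\<forall>k<\<nu>. \<forall>x\<ge>0. (D k has_vector_derivative D (Suc k) x) (at x within {0..})) \<and>
      (\<forall>k\<in>{1..\<nu>}. bounded (D k ` {0..}))
      \<longrightarrow> (\<exists>C. \<forall>N::nat. N > 0 \<longrightarrow> (\<forall>n\<le>N.
            norm (mild_sol S h r y0 (real n * (T / real N)) - eqrf S h r \<nu> c (T / real N) y0 n)
            \<le> C * (if r \<noteq> (real \<nu> - 1) / real \<nu>
                   then (T / real N) powr (min (1 + real \<nu> * r) (real \<nu>))
                   else (T / real N) ^ \<nu> * (1 + \<bar>ln (T / real N)\<bar>)))))
     \<and>
     ((\<forall>k<\<nu> + 1. \<forall>x\<ge>0. (D k has_vector_derivative D (Suc k) x) (at x within {0..})) \<and>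
      (\<forall>k\<in>{1..\<nu> + 1}. bounded (D k ` {0..})) \<and>
      (\<forall>x\<ge>0. D \<nu> x \<in> DA) \<and>
      bounded ((\<lambda>x. A (D \<nu> x)) ` {0..}) \<and>
      integral {0..1} (\<lambda>s. \<Prod>i\<in>{1..\<nu>}. (s - c i)) = 0
      \<longrightarrow> (\<exists>C. \<forall>N::nat. N > 0 \<longrightarrow> (\<forall>n\<le>N.
            norm (mild_sol S h r y0 (real n * (T / real N)) - eqrf S h r \<nu> c (T / real N) y0 n)
            \<le> C * (T / real N) powr (1 + real \<nu> * r))))"
proof (intro conjI impI, goal_cases)
  case 1
  then have D: "\<And>k x. k < \<nu> \<Longrightarrow> 0 \<le> x \<Longrightarrow> (D k has_vector_derivative D (Suc k) x) (at x within {0..})"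
    and bdd: "bounded (D \<nu> ` {0..})" using nu by auto
  obtain C where C: "C \<ge> 0" "\<And>N n. N > 0 \<Longrightarrow> n \<le> N \<Longrightarrow>
    norm (mild_sol S (D 0) r y0 (real n * (T / real N)) - eqrf S (D 0) r \<nu> c (T / real N) y0 n)
    \<le> C * ((T / real N) powr (1 + real \<nu> * r) * (\<Sum>k<N. max 1 (real k) powr ((r - 1) * real \<nu>)))"
    using eqrf_error_bound[OF sg T r nu c_range c_dist D bdd, where ?y0.0 = y0] by blast
  obtain C' where C': "\<And>N. N > 0 \<Longrightarrow>
    (T / real N) powr (1 + real \<nu> * r) * (\<Sum>k<N. max 1 (real k) powr ((r - 1) * real \<nu>))
    \<le> C' * (if r \<noteq> (real \<nu> - 1) / real \<nu> then (T / real N) powr (min (1 + real \<nu> * r) (real \<nu>))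
        else (T / real N) ^ \<nu> * (1 + \<bar>ln (T / real N)\<bar>))"
    using sum_step_scale_order[OF T r nu] by blast
  show ?case
    unfolding D0[symmetric]
  proof (intro exI[of _ "C * C'"] allI impI)
    fix N n :: nat assume N: "N > 0" "n \<le> N"
    show "norm (mild_sol S (D 0) r y0 (real n * (T / real N)) - eqrf S (D 0) r \<nu> c (T / real N) y0 n)
      \<le> C * C' * (if r \<noteq> (real \<nu> - 1) / real \<nu> then (T / real N) powr (min (1 + real \<nu> * r) (real \<nu>))
        else (T / real N) ^ \<nu> * (1 + \<bar>ln (T / real N)\<bar>))"
      using order_trans[OF C(2)[OF N] mult_left_mono[OF C'[OF N(1)] C(1)]] by (simp only: mult.assoc)
  qed
next
  case 2
  then have D: "\<And>k x. k < Suc \<nu> \<Longrightarrow> 0 \<le> x \<Longrightarrow> (D k has_vector_derivative D (Suc k) x) (at x within {0..})"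
    and bdd: "bounded (D \<nu> ` {0..})" "bounded (D (Suc \<nu>) ` {0..})"
    and DA: "\<And>x. 0 \<le> x \<Longrightarrow> D \<nu> x \<in> DA" and bddA: "bounded ((\<lambda>x. A (D \<nu> x)) ` {0..})"
    and c_int: "integral {0..1} (\<lambda>s. \<Prod>i\<in>{1..\<nu>}. (s - c i)) = 0"
    using nu by auto
  show ?case
    using eqrf_superconvergence[OF sg gen T r nu c_range c_dist D bdd DA bddA c_int, where ?y0.0 = y0]
    unfolding D0 by blast
qed

end
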